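(* For every integer $n\geq 9$, the independence number of the graph $\Gamma(n,1,n-3)$ equals $\binom{n}{4}+42$.
   Context: For a positive integer $n$ let $[n]=\{1,\dots,n\}$. Two subsets $X,Y\subseteq[n]$ are called opposite if $X\cap Y=\emptyset$ or $X\cup Y=[n]$. A flag of $[n]$ is a set $f$ of non-empty proper subsets of $[n]$ that is totally ordered by inclusion; its type is $\{|X| : X\in f\}$. Two flags $f_1,f_2$ are opposite if every element of $f_1$ is opposite to every element of $f_2$. For integers $1\le a<b<n$, $\Gamma(n,a,b)$ is the graph whose vertices are the flags of type $\{a,b\}$, i.e. pairs $(A,B)$ with $A\subseteq B\subseteq[n]$, $|A|=a$, $|B|=b$, two vertices being adjacent iff they are opposite as flags. For $\Gamma(n,1,n-3)$ with $n\ge 7$, vertices $(A_1,B_1),(A_2,B_2)$ are adjacent iff $B_1\cup B_2=[n]$, $A_1\cap B_2=\emptyset$ and $A_2\cap B_1=\emptyset$. The independence number is the maximum size of a set of pairwise non-adjacent vertices. *)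

theory Defs
  imports Complex_Main
begin

text \<open>A simple graph is a pair of a vertex set and a set of edges, the edges being two-element
  sets of vertices.\<close>

type_synonym 'v graph = "'v set \<times> 'v set set"

definition independent_set :: "'v graph \<Rightarrow> 'v set \<Rightarrow> bool" where
  "independent_set G S \<longleftrightarrow> S \<subseteq> fst G \<and> pairwise (\<lambda>u v. {u, v} \<notin> snd G) S"

text \<open>Meaningful for a finite vertex set: otherwise the maximum need not exist.\<close>

definition independence_number :: "'v graph \<Rightarrow> nat" where
  "independence_number G = Max (card ` {S. independent_set G S})"

definition opposite_sets :: "nat \<Rightarrow> nat set \<Rightarrow> nat set \<Rightarrow> bool" where
  "opposite_sets n X Y \<longleftrightarrow> X \<inter> Y = {} \<or> X \<union> Y = {1..n}"

definition flag :: "nat \<Rightarrow> nat set set \<Rightarrow> bool" where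
  "flag n f \<longleftrightarrow> (\<forall>X\<in>f. X \<noteq> {} \<and> X \<subset> {1..n}) \<and> chain\<^sub>\<subseteq> f"

definition flag_type :: "nat set set \<Rightarrow> nat set" where
  "flag_type f = card ` f"

definition opposite_flags :: "nat \<Rightarrow> nat set set \<Rightarrow> nat set set \<Rightarrow> bool" where
  "opposite_flags n f g \<longleftrightarrow> (\<forall>X\<in>f. \<forall>Y\<in>g. opposite_sets n X Y)"

definition Gamma_vertices :: "nat \<Rightarrow> nat \<Rightarrow> nat \<Rightarrow> nat set set set" where
  "Gamma_vertices n a b = {f. flag n f \<and> flag_type f = {a, b}}"

text \<open>No condition \<open>f \<noteq> g\<close> is needed for the edges: a non-empty flag is never opposite to itself
  (lemma \<open>not_opposite_flags_self\<close> below).\<close>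

definition Gamma :: "nat \<Rightarrow> nat \<Rightarrow> nat \<Rightarrow> nat set set graph" where
  "Gamma n a b =
    (Gamma_vertices n a b,
     {{f, g} | f g. f \<in> Gamma_vertices n a b \<and> g \<in> Gamma_vertices n a b \<and> opposite_flags n f g})"

lemma not_opposite_flags_self:
  assumes "f \<in> Gamma_vertices n a b"
  shows "\<not> opposite_flags n f f"
proof -
  from assms obtain X where "X \<in> f"
    by (auto simp: Gamma_vertices_def flag_type_def)
  with assms have "\<not> opposite_sets n X X"
    by (auto simp: Gamma_vertices_def flag_def opposite_sets_def)
  with \<open>X \<in> f\<close> show ?thesis
    by (auto simp: opposite_flags_def)
qed

end

theory Submission
  imports Defs
begin

text \<open>
  Write a flag \<open>{{a}, B}\<close> as a pair \<open>(a, C)\<close> with \<open>C = [n] - B\<close>, a triple avoiding \<open>a\<close>. Two pairs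
  \<open>(a, C)\<close>, \<open>(b, D)\<close> are adjacent iff \<open>C\<close> and \<open>D\<close> are disjoint, \<open>a \<in> D\<close> and \<open>b \<in> C\<close>. Hence a family is
  independent iff for all points \<open>b\<close>, \<open>v\<close> the links \<open>L b v = {e. (b, {v} \<union> e) in the family}\<close> and \<open>L v b\<close>,
  families of edges on the remaining points, are cross-intersecting.

  For the upper bound, \<open>b\<close> dominates \<open>v\<close> if \<open>L v b\<close> has at most one element, and \<open>b\<close>, \<open>v\<close> are tied if both
  links have at least two. A triple at \<open>b\<close> that contains points tied with \<open>b\<close> distributes its weight
  evenly among these points. Cross-intersecting families of at least two edges each are essentially
  two stars with a common centre, so the weight received along a tie is at most what two stars
  carry, and the family is bounded by a sum of a function \<open>\<psi>\<close> of the numbers \<open>d\<close> of dominated and \<open>t\<close>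
  of tied points of each vertex.

  This sum is bounded for arbitrary asymmetric relations by induction on the number of points.
  Deleting a point of maximal \<open>d\<close> costs at most \<open>n - 1 choose 3\<close> if \<open>d \<ge> 7\<close> or \<open>n \<ge> 11\<close>. In the
  remaining cases \<open>\<psi>\<close> is at most a multiple of the score \<open>2 d + t\<close>, and the scores add up to
  \<open>n (n - 1)\<close>.

  For the lower bound, take at each \<open>a \<ge> 10\<close> all triples below \<open>a\<close>, and at each \<open>a\<close> with \<open>2 \<le> a \<le> 9\<close>
  all triples in \<open>[9] - {a}\<close> through \<open>1\<close>.
\<close>

section \<open>The weight of a vertex\<close>

text \<open>All weights are scaled by 6. The values of \<open>cap\<close> bound the weights of 4-cycles, triangles and
  (with 6 added) pairs of incident edges; the linear term of \<open>tie_weight\<close> bounds the weight of a star,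
  and \<open>extra\<close> accounts for the dominated points \<open>v\<close> whose link \<open>L v b\<close> has exactly one element. It
  has to vanish at \<open>d = 1\<close>, \<open>t = 7\<close>: for \<open>n = 9\<close> the extremal family has eight such vertices.\<close>

definition cap :: "nat \<Rightarrow> int" where
  "cap d = (if d = 0 then 10 else if d = 1 then 12 else if d = 2 then 15 else if d = 3 then 18 else 24)"

definition tie_weight :: "nat \<Rightarrow> nat \<Rightarrow> int" where
  "tie_weight d t = max (cap d) (6 * int d + 3 * int t - (if d = 0 then 11 else 9))"

definition extra :: "nat \<Rightarrow> nat \<Rightarrow> int" where
  "extra d t = (if 1 \<le> d \<and> d \<le> 5 \<and> \<not> (d = 1 \<and> 7 \<le> t) then 6 * int d else 0)"

text \<open>The cubic term is six times \<open>d choose 3\<close>, for the triples inside the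
  dominated set; \<open>extra\<close> pays for one-edge links, and each of the t ties brings in at
  most \<open>tie_weight d t\<close>.\<close>

definition \<psi> :: "nat \<Rightarrow> nat \<Rightarrow> int" where
  "\<psi> d t = int d * (int d - 1) * (int d - 2) + extra d t + int t * tie_weight d t"

section \<open>Growth of \<open>\<psi>\<close> when one tied or dominated point is added\<close>

lemma \<psi>_Suc_tie:
  assumes "d + Suc s \<le> m" "7 \<le> m"
  shows "\<psi> d (Suc s) \<le> \<psi> d s + 6 * (int m - 2)"
proof -
  have e: "extra d (Suc s) \<le> extra d s" by (auto simp: extra_def)
  define y where "y = 6 * int d + 3 * int s - (if d = 0 then 11 else 9)"
  have w: "tie_weight d (Suc s) = max (cap d) (y + 3)" "tie_weight d s = max (cap d) y"
    by (auto simp: tie_weight_def y_def)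
  have c: "cap d \<le> 24" by (auto simp: cap_def)
  have "int (Suc s) * tie_weight d (Suc s) \<le> int s * tie_weight d s + 6 * (int m - 2)"
  proof (cases "cap d \<le> y + 3")
    case True
    have "int s * y \<le> int s * tie_weight d s" using w by (intro mult_left_mono) auto
    moreover have "int (Suc s) * tie_weight d (Suc s) = int s * y + (y + 3 * int s + 3)"
      using w True by (simp add: algebra_simps)
    \<comment> \<open>For d > 0 the left side is 6 (d + Suc s) - 12, so the bound is attained at d +
      Suc s = m.\<close>
    moreover have "y + 3 * int s + 3 \<le> 6 * (int m - 2)"
      using assms by (auto simp: y_def split: if_splits)
    ultimately show ?thesis by linarith
  next
    case False
    then have "tie_weight d (Suc s) = cap d" "tie_weight d s = cap d" using w by auto
    then show ?thesis using c assms by (simp add: algebra_simps)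
  qed
  with e show ?thesis by (simp add: \<psi>_def)
qed

lemma tie_weight_Suc: "1 \<le> d \<Longrightarrow> tie_weight (Suc d) t \<le> tie_weight d t + 6"
  by (auto simp: tie_weight_def cap_def)

text \<open>The linear term gains 6 from its slope and 2 more because its constant changes from 11
  to 9.\<close>

lemma tie_weight_Suc_0: "tie_weight (Suc 0) t \<le> tie_weight 0 t + 8"
  by (auto simp: tie_weight_def cap_def)

text \<open>The cubic term grows by exactly 3 d (d - 1). The 12 is needed for the jump of
  \<open>extra\<close> from 0 at d = 1, t \<ge> 7 to 12 at d = 2.\<close>

lemma \<psi>_Suc_out:
  "\<psi> (Suc d) t \<le> \<psi> d t + 3 * int d * (int d - 1) + 8 * int t + 12"
proof (cases "d = 0")
  case True
  have "int t * tie_weight (Suc 0) t \<le> int t * (tie_weight 0 t + 8)"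
    by (intro mult_left_mono tie_weight_Suc_0) auto
  then show ?thesis using True by (simp add: \<psi>_def extra_def algebra_simps)
next
  case False
  have "int t * tie_weight (Suc d) t \<le> int t * (tie_weight d t + 6)"
    using False by (intro mult_left_mono tie_weight_Suc) auto
  moreover have "extra (Suc d) t \<le> extra d t + 12" using False by (auto simp: extra_def)
  ultimately show ?thesis by (simp add: \<psi>_def algebra_simps)
qed

lemma \<psi>_Suc_out_small:
  assumes "Suc d + t \<le> m" "Suc d \<le> 6" "10 \<le> m"
  shows "\<psi> (Suc d) t \<le> \<psi> d t + 8 * (int m - 1)"
proof (cases "d = 0")
  case True
  show ?thesis
  proof (cases "7 \<le> t")
    case True
    have "int t * tie_weight (Suc 0) t \<le> int t * (tie_weight 0 t + 8)"
      by (intro mult_left_mono tie_weight_Suc_0) auto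
    then show ?thesis using \<open>d = 0\<close> True assms by (simp add: \<psi>_def extra_def algebra_simps)
  next
    case False
    then have "t \<in> {0,1,2,3,4,5,6}" by auto
    then show ?thesis using \<open>d = 0\<close> assms
      by (auto simp: \<psi>_def extra_def tie_weight_def cap_def)
  qed
next
  case False
  have *: "int t * tie_weight (Suc d) t \<le> int t * (tie_weight d t + 6)"
    using False by (intro mult_left_mono tie_weight_Suc) auto
  from False assms(2) have "d = 1 \<or> d = 2 \<or> d = 3 \<or> d = 4 \<or> d = 5" by auto
  then show ?thesis using * assms
    by (elim disjE) (auto simp: \<psi>_def extra_def algebra_simps)
qed

text \<open>The total cost of deleting a point with D dominated, t tied and e dominating points is
  at most 6 * (m choose 3). With R the divided difference of x (x - 1) (x - 2) between D and m, each
  of the m - D = t + e remaining points can be charged against R separately.\<close>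

lemma step_large:
  fixes D t e :: int
  assumes "7 \<le> D" "0 \<le> t" "0 \<le> e" "m = D + t + e"
  shows "D * (D - 1) * (D - 2) + t * (6 * D + 3 * t - 9) + t * (6 * (m - 2))
     + e * (3 * (D - 1) * (D - 2) + 8 * (m - D) + 12) \<le> m * (m - 1) * (m - 2)"
proof -
  define x where "x = t + e"
  have x: "0 \<le> x" "t \<le> x" "m = D + x" using assms by (auto simp: x_def)
  define R where "R = 3 * D^2 + 3 * D * x + x^2 - 6 * D - 3 * x + 2"
  have D: "7 * D \<le> D * D" "7 * x \<le> D * x" "0 \<le> x * x"
    using mult_right_mono[OF assms(1), of D] mult_right_mono[OF assms(1) x(1)] assms(1) by auto
  have "12 * D + 3 * t + 6 * x - 21 \<le> R"
    using D x assms unfolding R_def power2_eq_square by linarith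
  then have 1: "t * (12 * D + 3 * t + 6 * x - 21) \<le> t * R" using assms by (intro mult_left_mono)
  have "3 * D^2 - 9 * D + 18 + 8 * x \<le> R"
    using D x assms unfolding R_def power2_eq_square by linarith
  then have 2: "e * (3 * D^2 - 9 * D + 18 + 8 * x) \<le> e * R" using assms by (intro mult_left_mono)
  have "m * (m - 1) * (m - 2) = D * (D - 1) * (D - 2) + (t + e) * R"
    unfolding R_def x x_def by (simp add: power2_eq_square algebra_simps)
  with 1 2 show ?thesis unfolding x(3) by (simp add: power2_eq_square algebra_simps)
qed

lemma step_small:
  fixes D t e :: int
  assumes "0 \<le> D" "D \<le> 6" "0 \<le> t" "0 \<le> e" "m = D + t + e" "10 \<le> m"
  shows "D * (D - 1) * (D - 2) + 6 * D + t * max 24 (6 * D + 3 * t - 9) + t * (6 * (m - 2))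
     + e * (8 * (m - 1)) \<le> m * (m - 1) * (m - 2)"
proof -
  \<comment> \<open>A common bound for the cost per tied and per dominating point. At m = 10, D = 0
    it equals 72, as do 24 + 6 (m - 2) and 8 (m - 1).\<close>
  define R where "R = 9 * m + 3 * D - 18"
  have "max 24 (6 * D + 3 * t - 9) + 6 * (m - 2) \<le> R" using assms by (auto simp: R_def)
  then have 1: "t * (max 24 (6 * D + 3 * t - 9) + 6 * (m - 2)) \<le> t * R"
    using assms by (intro mult_left_mono)
  have "8 * (m - 1) \<le> R" using assms by (auto simp: R_def)
  then have 2: "e * (8 * (m - 1)) \<le> e * R" using assms by (intro mult_left_mono)
  have 3: "(t + e) * R = (m - D) * R" using assms by simp
  \<comment> \<open>The two sides differ by exactly m (m - 2) (m - 10) - D (D^2 - 6 D + 26 - 6 m);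
    hence the threshold m = 10.\<close>
  have "0 \<le> (m - 10) * (m * (m - 2))" using assms by simp
  moreover have "D * (D * D - 6 * D + 26 - 6 * m) \<le> 0"
  proof -
    have "D * D \<le> 6 * D" using assms by (intro mult_right_mono) auto
    then show ?thesis using assms by (intro mult_nonneg_nonpos) auto
  qed
  ultimately have "D * (D - 1) * (D - 2) + 6 * D + (m - D) * R \<le> m * (m - 1) * (m - 2)"
    unfolding R_def by (simp add: algebra_simps)
  with 1 2 3 show ?thesis by (simp add: algebra_simps)
qed

text \<open>The slope is the desired bound divided by n (n - 1), the total of all scores. For n = 9
  equality holds at (d, t) = (0, 0) and (1, 7), the values in the extremal family. For n = 8 the
  inequality fails at (7, 0), so large d needs another argument.\<close>

lemma \<psi>_le_linear:
  assumes "d \<le> 6" "d + t < n" "7 \<le> n" "n \<le> 10"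
  shows "int (n * (n - 1)) * \<psi> d t \<le> 6 * int ((n choose 4) + 42) * int (2 * d + t)"
proof -
  have n: "n \<in> {7,8,9,10}" using assms by auto
  have d: "d \<in> {0,1,2,3,4,5,6}" using assms by auto
  have t: "t \<in> {0,1,2,3,4,5,6,7,8,9}" using assms by auto
  have c: "(7 choose 4) = (35::nat)" "(8 choose 4) = (70::nat)" "(9 choose 4) = (126::nat)" "(10 choose 4) = (210::nat)"
    by (simp_all add: binomial_fact_lemma eval_nat_numeral)
  show ?thesis using n d t assms(2) 
    by (elim insertE emptyE; simp add: \<psi>_def extra_def tie_weight_def cap_def c)
qed

section \<open>Relations with ties\<close>

definition outs :: "'a set \<Rightarrow> ('a \<Rightarrow> 'a \<Rightarrow> bool) \<Rightarrow> 'a \<Rightarrow> nat" where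
  "outs V R b = card {v \<in> V. R b v}"

definition ties :: "'a set \<Rightarrow> ('a \<Rightarrow> 'a \<Rightarrow> bool) \<Rightarrow> 'a \<Rightarrow> nat" where
  "ties V R b = card {v \<in> V. v \<noteq> b \<and> \<not> R b v \<and> \<not> R v b}"

definition ins :: "'a set \<Rightarrow> ('a \<Rightarrow> 'a \<Rightarrow> bool) \<Rightarrow> 'a \<Rightarrow> nat" where
  "ins V R b = card {v \<in> V. R v b}"

lemma outs_ties_ins:
  assumes "finite V" "b \<in> V" "asymp R"
  shows "outs V R b + ties V R b + ins V R b + 1 = card V"
proof -
  let ?O = "{v \<in> V. R b v}" and ?T = "{v \<in> V. v \<noteq> b \<and> \<not> R b v \<and> \<not> R v b}" and ?I = "{v \<in> V. R v b}"
  note asym = asympD[OF assms(3)]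
  have "V = insert b (?O \<union> ?T \<union> ?I)" using assms(2) by auto
  moreover have "card (insert b (?O \<union> ?T \<union> ?I)) = Suc (card (?O \<union> ?T \<union> ?I))"
    using assms(1) by (intro card_insert_disjoint) (auto dest: asym)
  moreover have "card (?O \<union> ?T \<union> ?I) = card (?O \<union> ?T) + card ?I"
    using assms(1) by (intro card_Un_disjoint) (auto dest: asym)
  moreover have "card (?O \<union> ?T) = card ?O + card ?T"
    using assms by (intro card_Un_disjoint) auto
  ultimately show ?thesis by (simp add: outs_def ties_def ins_def)
qed

lemma sum_outs_eq_sum_ins:
  assumes "finite V"
  shows "(\<Sum>b\<in>V. outs V R b) = (\<Sum>b\<in>V. ins V R b)"
proof -
  have "(\<Sum>b\<in>V. outs V R b) = (\<Sum>b\<in>V. \<Sum>v\<in>V. if R b v then 1 else 0)"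
    using assms by (simp add: outs_def ins_def flip: sum.inter_filter)
  also have "\<dots> = (\<Sum>v\<in>V. \<Sum>b\<in>V. if R b v then 1 else 0)" by (rule sum.swap)
  also have "\<dots> = (\<Sum>b\<in>V. ins V R b)"
    using assms by (simp add: outs_def ins_def flip: sum.inter_filter)
  finally show ?thesis .
qed

text \<open>As in a tournament with draws, every pair of points distributes a score of 2.\<close>

lemma sum_scores:
  assumes "finite V" "asymp R"
  shows "(\<Sum>b\<in>V. 2 * outs V R b + ties V R b) = card V * (card V - 1)"
proof -
  have "(\<Sum>b\<in>V. 2 * outs V R b + ties V R b) = (\<Sum>b\<in>V. outs V R b + ties V R b) + (\<Sum>b\<in>V. outs V R b)"
    by (simp only: sum.distrib[symmetric]) (rule sum.cong; simp)
  also have "\<dots> = (\<Sum>b\<in>V. outs V R b + ties V R b + ins V R b)"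
    using assms by (simp add: sum_outs_eq_sum_ins sum.distrib)
  also have "\<dots> = (\<Sum>b\<in>V. card V - 1)"
  proof (rule sum.cong)
    fix b assume "b \<in> V"
    from outs_ties_ins[OF assms(1) this assms(2)]
    show "outs V R b + ties V R b + ins V R b = card V - 1" by simp
  qed simp
  finally show ?thesis by simp
qed

lemma card_Diff_filter:
  assumes "finite V" "v \<in> V"
  shows "card {x \<in> V. P x} = card {x \<in> V - {v}. P x} + (if P v then 1 else 0)"
proof (cases "P v")
  case True
  then have "{x \<in> V. P x} = insert v {x \<in> V - {v}. P x}" using assms by auto
  then show ?thesis using True assms by simp
next
  case False
  then have "{x \<in> V. P x} = {x \<in> V - {v}. P x}" by auto
  then show ?thesis using False by simp
qed

lemma int_choose_3: "6 * int (m choose 3) = int m * (int m - 1) * (int m - 2)"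
proof (induction m)
  case (Suc m)
  have "2 * int (m choose 2) = int m * (int m - 1)"
    by (induction m) (auto simp: numeral_2_eq_2 algebra_simps)
  with Suc show ?case by (simp add: numeral_3_eq_3 numeral_2_eq_2 algebra_simps)
qed simp

lemma sum_\<psi>_le_small:
  assumes "finite V" and asym: "asymp R"
    and n: "7 \<le> card V" "card V \<le> 10" and small: "\<And>b. b \<in> V \<Longrightarrow> outs V R b \<le> 6"
  shows "(\<Sum>b\<in>V. \<psi> (outs V R b) (ties V R b)) \<le> 6 * int ((card V choose 4) + 42)"
proof -
  let ?n = "card V" and ?B = "6 * int ((card V choose 4) + 42)"
  have "int (?n * (?n - 1)) * (\<Sum>b\<in>V. \<psi> (outs V R b) (ties V R b))
      = (\<Sum>b\<in>V. int (?n * (?n - 1)) * \<psi> (outs V R b) (ties V R b))" by (rule sum_distrib_left)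
  also have "\<dots> \<le> (\<Sum>b\<in>V. ?B * int (2 * outs V R b + ties V R b))"
  proof (rule sum_mono)
    fix b assume "b \<in> V"
    then have "outs V R b + ties V R b < card V"
      using outs_ties_ins[OF assms(1) _ asym] by fastforce
    with \<open>b \<in> V\<close> show "int (?n * (?n - 1)) * \<psi> (outs V R b) (ties V R b)
        \<le> ?B * int (2 * outs V R b + ties V R b)"
      using small n by (intro \<psi>_le_linear) auto
  qed
  also have "\<dots> = ?B * int (\<Sum>b\<in>V. 2 * outs V R b + ties V R b)"
    by (simp add: sum_distrib_left)
  also have "\<dots> = int (?n * (?n - 1)) * ?B"
    using sum_scores[OF assms(1) asym] by simp
  finally show ?thesis
    using n by (subst (asm) mult_le_cancel_left_pos) auto
qed

text \<open>Deleting v removes a tie (cost T) or a dominated point (cost I) from the other points;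
  points dominated by v are unaffected. Since v has maximal out-degree, the costs are only required
  for d up to that degree.\<close>

lemma sum_\<psi>_remove:
  assumes "finite V" and asym: "asymp R" and "v \<in> V"
    and T: "\<And>d t. d \<le> outs V R v \<Longrightarrow> d + Suc t < card V \<Longrightarrow> \<psi> d (Suc t) \<le> \<psi> d t + T"
    and I: "\<And>d t. Suc d \<le> outs V R v \<Longrightarrow> Suc d + t < card V \<Longrightarrow> \<psi> (Suc d) t \<le> \<psi> d t + I"
    and max: "\<And>b. b \<in> V \<Longrightarrow> outs V R b \<le> outs V R v"
  shows "(\<Sum>b\<in>V. \<psi> (outs V R b) (ties V R b))
    \<le> \<psi> (outs V R v) (ties V R v) + int (ties V R v) * T + int (ins V R v) * I
      + (\<Sum>b\<in>V - {v}. \<psi> (outs (V - {v}) R b) (ties (V - {v}) R b))"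
proof -
  let ?W = "V - {v}"
  have no_rev: "R x y \<Longrightarrow> \<not> R y x" for x y using asym by (rule asympD)
  then have irr: "\<not> R x x" for x by blast
  have step: "\<psi> (outs V R b) (ties V R b) \<le> \<psi> (outs ?W R b) (ties ?W R b)
     + ((if \<not> R v b \<and> \<not> R b v then T else 0) + (if R b v then I else 0))" if b: "b \<in> ?W" for b
  proof -
    have o: "outs V R b = outs ?W R b + (if R b v then 1 else 0)"
      and t: "ties V R b = ties ?W R b + (if v \<noteq> b \<and> \<not> R b v \<and> \<not> R v b then 1 else 0)"
      unfolding outs_def ties_def by (rule card_Diff_filter[OF assms(1,3)])+
    have c: "outs V R b + ties V R b < card V"
      using outs_ties_ins[OF assms(1) _ asym, of b] b by simp
    have m: "outs V R b \<le> outs V R v" using max b by auto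
    consider "R b v" "\<not> R v b" | "R v b" "\<not> R b v" | "\<not> R v b" "\<not> R b v" using no_rev by blast
    then show ?thesis
      by cases (use o t c m b I T in auto)
  qed
  have "(\<Sum>b\<in>V. \<psi> (outs V R b) (ties V R b))
      = \<psi> (outs V R v) (ties V R v) + (\<Sum>b\<in>?W. \<psi> (outs V R b) (ties V R b))"
    using assms by (simp add: sum.remove)
  also have "(\<Sum>b\<in>?W. \<psi> (outs V R b) (ties V R b)) \<le> (\<Sum>b\<in>?W. \<psi> (outs ?W R b) (ties ?W R b)
     + ((if \<not> R v b \<and> \<not> R b v then T else 0) + (if R b v then I else 0)))"
    by (intro sum_mono step)
  also have "\<dots> = (\<Sum>b\<in>?W. \<psi> (outs ?W R b) (ties ?W R b))
     + (int (card {b \<in> ?W. \<not> R v b \<and> \<not> R b v}) * T + int (card {b \<in> ?W. R b v}) * I)"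
    using assms(1) by (simp add: sum.distrib sum.inter_filter[symmetric])
  also have "{b \<in> ?W. \<not> R v b \<and> \<not> R b v} = {b \<in> V. b \<noteq> v \<and> \<not> R v b \<and> \<not> R b v}" by auto
  also have "{b \<in> ?W. R b v} = {b \<in> V. R b v}" using irr by auto
  finally show ?thesis by (simp add: ties_def ins_def)
qed

lemma sum_\<psi>_le:
  assumes "finite V" and asym: "asymp R" and "7 \<le> card V"
  shows "(\<Sum>b\<in>V. \<psi> (outs V R b) (ties V R b)) \<le> 6 * int ((card V choose 4) + 42)"
  using assms(1,3)
proof (induction "card V" arbitrary: V rule: less_induct)
  case less
  show ?case
  proof (cases "card V \<le> 10 \<and> (\<forall>b\<in>V. outs V R b \<le> 6)")
    case True
    then show ?thesis using less.prems asym by (intro sum_\<psi>_le_small) auto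
  next
    case False
    define D where "D = Max (outs V R ` V)"
    have "V \<noteq> {}" using less.prems by auto
    then have "D \<in> outs V R ` V" unfolding D_def using less.prems by (intro Max_in) auto
    then obtain v where v: "v \<in> V" "outs V R v = D" by auto
    have max: "outs V R b \<le> D" if "b \<in> V" for b
      unfolding D_def using that less.prems by (intro Max_ge) auto
    define m where "m = card V - 1"
    have cW: "card (V - {v}) = m" "card V = Suc m" using v less.prems by (auto simp: m_def)
    have deg: "int m = int D + int (ties V R v) + int (ins V R v)"
      using outs_ties_ins[OF less.prems(1) v(1) asym] v(2) cW by simp
    have big: "7 \<le> D \<or> D \<le> 6 \<and> 10 \<le> m"
    proof (cases "card V \<le> 10")
      case True
      then obtain b where "b \<in> V" "\<not> outs V R b \<le> 6" using False by blast
      then show ?thesis using max[of b] by simp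
    next
      case False
      then show ?thesis using cW by auto
    qed
    then have m7: "7 \<le> m" using deg by auto
    \<comment> \<open>For D \<ge> 7 this is the increment in \<open>\<psi>_Suc_out\<close> at d = D
      - 1 with the largest possible t, namely m - D.\<close>
    define I :: int where "I = (if 7 \<le> D then 3 * (int D - 1) * (int D - 2) + 8 * (int m - int D) + 12
      else 8 * (int m - 1))"
    have "(\<Sum>b\<in>V. \<psi> (outs V R b) (ties V R b))
      \<le> \<psi> D (ties V R v) + int (ties V R v) * (6 * (int m - 2)) + int (ins V R v) * I
      + (\<Sum>b\<in>V - {v}. \<psi> (outs (V - {v}) R b) (ties (V - {v}) R b))"
      unfolding v(2)[symmetric]
    proof (rule sum_\<psi>_remove)
      fix d t assume "d + Suc t < card V"
      then show "\<psi> d (Suc t) \<le> \<psi> d t + 6 * (int m - 2)"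
        using m7 cW by (intro \<psi>_Suc_tie) auto
    next
      fix d t assume *: "Suc d \<le> outs V R v" "Suc d + t < card V"
      show "\<psi> (Suc d) t \<le> \<psi> d t + I"
      proof (cases "7 \<le> D")
        case True
        have "\<psi> (Suc d) t \<le> \<psi> d t + 3 * int d * (int d - 1) + 8 * int t + 12" by (rule \<psi>_Suc_out)
        moreover have "3 * int d * (int d - 1) + 8 * int t + 12 \<le> I"
        proof -
          \<comment> \<open>Lowering d by u below D - 1 permits u more ties, worth 8 u, but loses 3
            u (u + 2 d - 1) in the quadratic term, which is more if u > 0 because D \<ge> 7.\<close>
          define u where "u = int D - 1 - int d"
          have u: "0 \<le> u" "0 \<le> int d" using * v by (auto simp: u_def)
          have D: "int D = u + int d + 1" by (simp add: u_def)
          have "0 \<le> u * (3 * (u + 2 * int d - 1) - 8)"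
          proof (cases "u = 0")
            case False
            then show ?thesis using u True D by (intro mult_nonneg_nonneg) auto
          qed simp
          moreover have "8 * int t \<le> 8 * (int m - int d - 1)" using * cW by auto
          ultimately show ?thesis using True unfolding I_def D by (simp add: algebra_simps)
        qed
        ultimately show ?thesis by linarith
      next
        case False
        then show ?thesis using * cW v(2) big \<psi>_Suc_out_small[of d t m] by (auto simp: I_def)
      qed
    qed (use less.prems v max asym in auto)
    \<comment> \<open>The right side is 6 * (m choose 3), the increment of the claimed bound by
      Pascal's rule.\<close>
    also have "\<psi> D (ties V R v) + int (ties V R v) * (6 * (int m - 2)) + int (ins V R v) * I
      \<le> int m * (int m - 1) * (int m - 2)"
    proof (cases "7 \<le> D")
      case True
      have "\<psi> D (ties V R v) = int D * (int D - 1) * (int D - 2)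
          + int (ties V R v) * (6 * int D + 3 * int (ties V R v) - 9)"
        using True by (auto simp: \<psi>_def extra_def tie_weight_def cap_def)
      with True show ?thesis
        using step_large[of "int D" "int (ties V R v)" "int (ins V R v)" "int m"] deg
        by (simp add: I_def)
    next
      case False
      have "tie_weight D (ties V R v) \<le> max 24 (6 * int D + 3 * int (ties V R v) - 9)"
        by (auto simp: tie_weight_def cap_def)
      then have "int (ties V R v) * tie_weight D (ties V R v)
        \<le> int (ties V R v) * max 24 (6 * int D + 3 * int (ties V R v) - 9)"
        by (intro mult_left_mono) auto
      moreover have "extra D (ties V R v) \<le> 6 * int D" by (auto simp: extra_def)
      ultimately show ?thesis
        using False step_small[of "int D" "int (ties V R v)" "int (ins V R v)" "int m"] deg big
        by (simp add: I_def \<psi>_def)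
    qed
    also have "(\<Sum>b\<in>V - {v}. \<psi> (outs (V - {v}) R b) (ties (V - {v}) R b)) \<le> 6 * int ((m choose 4) + 42)"
      using less.hyps[of "V - {v}"] less.prems cW m7 by simp
    finally have "(\<Sum>b\<in>V. \<psi> (outs V R b) (ties V R b)) \<le> 6 * int (m choose 3) + 6 * int ((m choose 4) + 42)"
      by (simp add: int_choose_3)
    moreover have "card V choose 4 = (m choose 3) + (m choose 4)"
      using cW by (simp add: numeral_eq_Suc)
    ultimately show ?thesis by simp
  qed
qed

section \<open>Cross-intersecting families of edges\<close>

lemma doubleton_meets_two:
  assumes "card e = 2" "distinct [a, b, x, y]" "e \<inter> {a, b} \<noteq> {}" "e \<inter> {x, y} \<noteq> {}"
  shows "e \<in> {{a, x}, {a, y}, {b, x}, {b, y}}"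
proof -
  obtain p q where "e = {p, q}" using assms(1) by (auto simp: card_2_iff)
  then show ?thesis using assms(2-4) by (auto simp: doubleton_eq_iff)
qed

lemma doubleton_other:
  assumes "card e = 2" "x \<in> e"
  obtains y where "e = {x, y}" "y \<noteq> x"
  using assms by (auto simp: card_2_iff)

text \<open>An interface for one side of a tie: c bounds the small configurations, S the stars. The
  6 in \<open>cherry\<close> is set aside for the single off-centre edge that the opposite family
  may then contain.\<close>

locale edge_weight =
  fixes G :: "'a set set" and w :: "'a set \<Rightarrow> int" and c S :: int
  assumes finite: "finite G"
    and edge: "e \<in> G \<Longrightarrow> card e = 2"
    and nonneg: "0 \<le> w e"
    and le_6: "w e \<le> 6"
    and quad: "distinct [a, b, x, y] \<Longrightarrow> w {a, x} + w {a, y} + w {b, x} + w {b, y} \<le> c"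
    and triangle: "distinct [a, b, x] \<Longrightarrow> w {a, b} + w {b, x} + w {a, x} \<le> c"
    and cherry: "distinct [a, x, y] \<Longrightarrow> w {a, x} + w {a, y} + 6 \<le> c"
    and cap_le: "c \<le> S"
    and star: "sum w {e \<in> G. x \<in> e} \<le> S"
begin

lemma sum_le_sum: "G \<subseteq> A \<Longrightarrow> finite A \<Longrightarrow> sum w G \<le> sum w A"
  using nonneg by (intro sum_mono2) auto

lemma star_le:
  assumes "\<And>e. e \<in> G \<Longrightarrow> x \<in> e"
  shows "sum w G \<le> S"
proof -
  have "{e \<in> G. x \<in> e} = G" using assms by auto
  then show ?thesis using star[of x] by simp
qed

lemma quad_le:
  assumes "distinct [a, b, x, y]" "\<And>e. e \<in> G \<Longrightarrow> e \<inter> {a, b} \<noteq> {}" "\<And>e. e \<in> G \<Longrightarrow> e \<inter> {x, y} \<noteq> {}"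
  shows "sum w G \<le> S"
proof -
  have "G \<subseteq> {{a, x}, {a, y}, {b, x}, {b, y}}"
  proof
    fix e assume "e \<in> G"
    then show "e \<in> {{a, x}, {a, y}, {b, x}, {b, y}}"
      using assms by (intro doubleton_meets_two edge)
  qed
  then have "sum w G \<le> sum w {{a, x}, {a, y}, {b, x}, {b, y}}" by (rule sum_le_sum) simp
  also have "\<dots> = w {a, x} + w {a, y} + w {b, x} + w {b, y}"
    using assms(1) by (auto simp: doubleton_eq_iff)
  finally show ?thesis using quad[OF assms(1)] cap_le by linarith
qed

lemma triangle_le:
  assumes "distinct [a, b, x]" "\<And>e. e \<in> G \<Longrightarrow> e \<subseteq> {a, b, x}"
  shows "sum w G \<le> S"
proof -
  have "G \<subseteq> {{a, b}, {b, x}, {a, x}}"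
  proof
    fix e assume "e \<in> G"
    then obtain p q where "e = {p, q}" "p \<noteq> q" using edge[of e] by (auto simp: card_2_iff)
    then show "e \<in> {{a, b}, {b, x}, {a, x}}"
      using assms(2)[OF \<open>e \<in> G\<close>] by (auto simp: doubleton_eq_iff)
  qed
  then have "sum w G \<le> sum w {{a, b}, {b, x}, {a, x}}" by (rule sum_le_sum) simp
  also have "\<dots> = w {a, b} + w {b, x} + w {a, x}"
    using assms(1) by (auto simp: doubleton_eq_iff)
  finally show ?thesis using triangle[OF assms(1)] cap_le by linarith
qed

lemma cherry_le:
  assumes "distinct [a, x, y]" "G \<subseteq> {{a, x}, {a, y}}"
  shows "sum w G + 6 \<le> S"
proof -
  have "sum w G \<le> sum w {{a, x}, {a, y}}" using assms by (intro sum_le_sum) auto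
  also have "\<dots> = w {a, x} + w {a, y}" using assms(1) by (auto simp: doubleton_eq_iff)
  finally show ?thesis using cherry[OF assms(1)] cap_le by linarith
qed

lemma star_insert_le:
  assumes "G \<subseteq> insert f {e. x \<in> e}"
  shows "sum w G \<le> S + 6"
proof -
  have "sum w G \<le> sum w (insert f {e \<in> G. x \<in> e})"
    using assms finite by (intro sum_le_sum) auto
  also have "\<dots> \<le> sum w {e \<in> G. x \<in> e} + 6"
    using finite le_6[of f] nonneg[of f] by (simp add: sum.insert_if)
  finally show ?thesis using star[of x] by linarith
qed

end

text \<open>Two edges xy and xz of H leave yz as the only possible edge of G off x. As G is no star,
  yz does occur, and this confines H to xy and xz. So G exceeds a star by at most 6, and H, being a
  cherry, has 6 to spare.\<close>

lemma cross_star_le: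
  assumes "edge_weight G w c S" "edge_weight H w' c' S'"
    and cross: "\<And>e h. e \<in> G \<Longrightarrow> h \<in> H \<Longrightarrow> e \<inter> h \<noteq> {}"
    and "2 \<le> card H" and x: "\<And>h. h \<in> H \<Longrightarrow> x \<in> h" and G: "\<And>y. \<exists>e\<in>G. y \<notin> e"
  shows "sum w G + sum w' H \<le> S + S'"
proof -
  interpret G: edge_weight G w c S by fact
  interpret H: edge_weight H w' c' S' by fact
  obtain h1 h2 where h: "h1 \<in> H" "h2 \<in> H" "h1 \<noteq> h2"
  proof -
    have "\<not> card H \<le> Suc 0" using \<open>2 \<le> card H\<close> by simp
    then show ?thesis using that by (auto simp: card_le_Suc0_iff_eq[OF H.finite])
  qed
  obtain y where y: "h1 = {x, y}" "y \<noteq> x" using H.edge[OF h(1)] x[OF h(1)] by (rule doubleton_other)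
  obtain z where z: "h2 = {x, z}" "z \<noteq> x" using H.edge[OF h(2)] x[OF h(2)] by (rule doubleton_other)
  have yz: "y \<noteq> z" using h y z by auto
  have e: "e = {y, z} \<or> x \<in> e" if eG: "e \<in> G" for e
  proof -
    obtain p q where "e = {p, q}" using G.edge[OF eG] by (auto simp: card_2_iff)
    then show ?thesis using cross[OF eG h(1)] cross[OF eG h(2)] y z yz by auto
  qed
  then have 1: "G \<subseteq> insert {y, z} {e. x \<in> e}" by auto
  obtain e0 where "e0 \<in> G" "x \<notin> e0" using G[of x] by auto
  then have "{y, z} \<in> G" using e by blast
  have "h = {x, y} \<or> h = {x, z}" if hH: "h \<in> H" for h
  proof -
    obtain p where "h = {x, p}" using H.edge[OF hH] x[OF hH] by (rule doubleton_other)
    then show ?thesis using cross[OF \<open>{y, z} \<in> G\<close> hH] y z by auto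
  qed
  then have "H \<subseteq> {{x, y}, {x, z}}" by auto
  then have "sum w' H + 6 \<le> S'" using y z yz by (intro H.cherry_le[of x y z]) auto
  with G.star_insert_le[OF 1] show ?thesis by linarith
qed

text \<open>Two disjoint edges of H force G into a 4-cycle. Given an edge ab of G, edges bx and ay
  of H avoiding a and b respectively are disjoint unless x = y. In that case G lies in the triangle
  abx, or an edge of G leaving the triangle yields another disjoint pair in H.\<close>

lemma cross_no_star_le:
  assumes "edge_weight G w c S" and H: "\<And>h. h \<in> H \<Longrightarrow> card h = 2"
    and cross: "\<And>e h. e \<in> G \<Longrightarrow> h \<in> H \<Longrightarrow> e \<inter> h \<noteq> {}"
    and nG: "\<And>y. \<exists>e\<in>G. y \<notin> e" and nH: "\<And>y. \<exists>h\<in>H. y \<notin> h"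
  shows "sum w G \<le> S"
proof -
  interpret edge_weight G w c S by fact
  obtain g where g: "g \<in> G" using nG by blast
  then obtain a b where ab: "g = {a, b}" "a \<noteq> b" using edge[OF g] by (auto simp: card_2_iff)
  obtain h1 where h1: "h1 \<in> H" "a \<notin> h1" using nH by blast
  then have "b \<in> h1" using cross[OF g h1(1)] ab by auto
  with H[OF h1(1)] obtain x where x: "h1 = {b, x}" "x \<noteq> b" by (rule doubleton_other)
  then have xa: "x \<noteq> a" using h1 by auto
  obtain h2 where h2: "h2 \<in> H" "b \<notin> h2" using nH by blast
  then have "a \<in> h2" using cross[OF g h2(1)] ab by auto
  with H[OF h2(1)] obtain y where y: "h2 = {a, y}" "y \<noteq> a" by (rule doubleton_other)
  then have yb: "y \<noteq> b" using h2 by auto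
  show ?thesis
  proof (cases "x = y")
    case False
    show ?thesis
      by (rule quad_le[of b x a y]) (use False ab x xa y yb cross[OF _ h1(1)] cross[OF _ h2(1)] in auto)
  next
    case True
    show ?thesis
    proof (cases "\<forall>e\<in>G. e \<subseteq> {a, b, x}")
      case True
      then show ?thesis using ab x xa by (intro triangle_le[of a b x]) auto
    next
      case False
      then obtain e where e: "e \<in> G" "\<not> e \<subseteq> {a, b, x}" by auto
      obtain p q where pq: "e = {p, q}" using edge[OF e(1)] by (auto simp: card_2_iff)
      then have "x \<in> e"
        using e cross[OF e(1) h1(1)] cross[OF e(1) h2(1)] x y \<open>x = y\<close> ab by auto
      with edge[OF e(1)] obtain z where z: "e = {x, z}" "z \<noteq> x" by (rule doubleton_other)
      then have zab: "z \<noteq> a" "z \<noteq> b" using e by auto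
      \<comment> \<open>Avoiding x but meeting xz and ab, \<open>h3\<close> is az or bz, hence
        disjoint from \<open>h1\<close> or \<open>h2\<close> respectively.\<close>
      obtain h3 where h3: "h3 \<in> H" "x \<notin> h3" using nH by blast
      obtain p' q' where "h3 = {p', q'}" using H[OF h3(1)] by (auto simp: card_2_iff)
      then have "h3 = {a, z} \<or> h3 = {b, z}"
        using h3 cross[OF e(1) h3(1)] cross[OF g h3(1)] ab z zab by auto
      then show ?thesis
      proof
        assume "h3 = {a, z}"
        then show ?thesis
          by (intro quad_le[of a z b x]) (use ab x xa z zab cross[OF _ h1(1)] cross[OF _ h3(1)] in auto)
      next
        assume "h3 = {b, z}"
        then show ?thesis
          by (intro quad_le[of b z a x])
            (use ab x xa y z zab \<open>x = y\<close> cross[OF _ h2(1)] cross[OF _ h3(1)] in auto)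
      qed
    qed
  qed
qed

lemma cross_le:
  assumes G: "edge_weight G w c S" and H: "edge_weight H w' c' S'"
    and cross: "\<And>e h. e \<in> G \<Longrightarrow> h \<in> H \<Longrightarrow> e \<inter> h \<noteq> {}"
    and card: "2 \<le> card G" "2 \<le> card H"
  shows "sum w G + sum w' H \<le> S + S'"
proof -
  interpret G: edge_weight G w c S by fact
  interpret H: edge_weight H w' c' S' by fact
  have cross': "h \<inter> e \<noteq> {}" if "h \<in> H" "e \<in> G" for h e using cross that by blast
  show ?thesis
  proof (cases "\<exists>x. \<forall>e\<in>G. x \<in> e")
    case True
    then obtain x where x: "\<And>e. e \<in> G \<Longrightarrow> x \<in> e" by auto
    show ?thesis
    proof (cases "\<exists>y. \<forall>h\<in>H. y \<in> h")
      case True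
      then obtain y where y: "\<And>h. h \<in> H \<Longrightarrow> y \<in> h" by auto
      show ?thesis by (intro add_mono G.star_le[of x] H.star_le[of y] x y)
    next
      case False
      have "sum w' H + sum w G \<le> S' + S"
        by (rule cross_star_le[OF H G cross' card(1) x]) (use False in auto)
      then show ?thesis by simp
    qed
  next
    case nG: False
    show ?thesis
    proof (cases "\<exists>y. \<forall>h\<in>H. y \<in> h")
      case True
      then obtain y where y: "\<And>h. h \<in> H \<Longrightarrow> y \<in> h" by auto
      show ?thesis by (rule cross_star_le[OF G H cross card(2) y]) (use nG in auto)
    next
      case False
      have "sum w G \<le> S" by (rule cross_no_star_le[OF G H.edge cross]) (use False nG in auto)
      moreover have "sum w' H \<le> S'"
        by (rule cross_no_star_le[OF H G.edge cross']) (use False nG in auto)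
      ultimately show ?thesis by simp
    qed
  qed
qed

text \<open>The share of a tied point \<open>v \<in> B\<close> in the weight 6 of the triple \<open>{v} \<union> e\<close>.\<close>

definition edge_wt :: "'a set \<Rightarrow> 'a set \<Rightarrow> 'a set \<Rightarrow> int" where
  "edge_wt A B e = (if e \<subseteq> A \<union> B then if e \<inter> B = {} then 6 else if e \<inter> A = {} then 2 else 3 else 0)"

section \<open>Shares carried by 4-cycles, triangles, cherries and stars\<close>

lemma edge_wt_nonneg: "0 \<le> edge_wt A B e" and edge_wt_le_6: "edge_wt A B e \<le> 6"
  by (auto simp: edge_wt_def)

lemma edge_wt_le:
  assumes "A \<inter> B = {}"
  shows "edge_wt A B {x, y} \<le> (if x \<in> A then if y \<in> A then 6 else 3 else if y \<in> A then 3 else 2)"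
  using assms by (auto simp: edge_wt_def)

text \<open>In this form the simplifier can bound \<open>card A\<close> from below after a case
  split on membership of each listed point.\<close>

lemma card_hits:
  assumes "finite A" "distinct xs"
  shows "(\<Sum>x\<leftarrow>xs. of_bool (x \<in> A)) \<le> int (card A)"
proof -
  have "(\<Sum>x\<leftarrow>xs. of_bool (x \<in> A)) = (\<Sum>x\<in>set xs. of_bool (x \<in> A) :: int)"
    using assms(2) by (simp add: sum_list_distinct_conv_sum_set)
  also have "\<dots> = int (card (set xs \<inter> A))"
    by (simp add: of_bool_def sum.If_cases)
  also have "\<dots> \<le> int (card A)" using assms(1) by (auto intro: card_mono)
  finally show ?thesis .
qed

text \<open>The values of \<open>cap\<close> come from cherries if \<open>card A\<close> is at most
  2; at 3 all three configurations can reach 18; from 4 on a 4-cycle inside A reaches 24.\<close>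

lemma edge_wt_quad:
  assumes "A \<inter> B = {}" "finite A" "distinct [a, b, x, y]"
  shows "edge_wt A B {a, x} + edge_wt A B {a, y} + edge_wt A B {b, x} + edge_wt A B {b, y} \<le> cap (card A)"
  using card_hits[OF assms(2,3)] edge_wt_le[OF assms(1), of a x] edge_wt_le[OF assms(1), of a y]
    edge_wt_le[OF assms(1), of b x] edge_wt_le[OF assms(1), of b y]
  by (cases "a \<in> A"; cases "b \<in> A"; cases "x \<in> A"; cases "y \<in> A"; simp add: cap_def)

lemma edge_wt_triangle:
  assumes "A \<inter> B = {}" "finite A" "distinct [a, b, x]"
  shows "edge_wt A B {a, b} + edge_wt A B {b, x} + edge_wt A B {a, x} \<le> cap (card A)"
  using card_hits[OF assms(2,3)] edge_wt_le[OF assms(1), of a b] edge_wt_le[OF assms(1), of b x]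
    edge_wt_le[OF assms(1), of a x]
  by (cases "a \<in> A"; cases "b \<in> A"; cases "x \<in> A"; simp add: cap_def)

lemma edge_wt_cherry:
  assumes "A \<inter> B = {}" "finite A" "distinct [a, x, y]"
  shows "edge_wt A B {a, x} + edge_wt A B {a, y} + 6 \<le> cap (card A)"
  using card_hits[OF assms(2,3)] edge_wt_le[OF assms(1), of a x] edge_wt_le[OF assms(1), of a y]
  by (cases "a \<in> A"; cases "x \<in> A"; cases "y \<in> A"; simp add: cap_def)

lemma sum_star_le:
  assumes "finite Y" "\<And>e. e \<in> E \<Longrightarrow> w e \<noteq> 0 \<Longrightarrow> e \<in> (\<lambda>y. {x, y}) ` Y" "\<And>e. 0 \<le> (w e :: int)" "finite E"
  shows "sum w E \<le> (\<Sum>y\<in>Y. w {x, y})"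
proof -
  have "sum w E = sum w {e \<in> E. w e \<noteq> 0}" using assms(4) by (intro sum.mono_neutral_right) auto
  also have "\<dots> \<le> sum w ((\<lambda>y. {x, y}) ` Y)" using assms by (intro sum_mono2) auto
  also have "\<dots> \<le> (\<Sum>y\<in>Y. w {x, y})"
    using sum_image_le[of Y w "\<lambda>y. {x, y}"] assms by (auto simp: o_def)
  finally show ?thesis .
qed

text \<open>Only edges inside \<open>A \<union> B\<close> count, and they avoid v. So the second
  endpoint ranges over what is left of A and B, and its location determines the share.\<close>

lemma edge_wt_star:
  assumes AB: "A \<inter> B = {}" "finite A" "finite B" "finite E" "v \<in> B"
    and E: "\<And>e. e \<in> E \<Longrightarrow> card e = 2 \<and> v \<notin> e \<and> x \<in> e"
  shows "sum (edge_wt A B) E \<le> (if x \<in> A then 6 * (int (card A) - 1) + 3 * (int (card B) - 1)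
     else if x \<in> B \<and> x \<noteq> v then 3 * int (card A) + 2 * (int (card B) - 2) else 0)"
proof -
  consider "x \<in> A" | "x \<in> B" "x \<noteq> v" "x \<notin> A" | "x \<notin> A" "x \<notin> B \<or> x = v" by blast
  then show ?thesis
  proof cases
    case 1
    let ?Y = "(A - {x}) \<union> (B - {v})"
    have "sum (edge_wt A B) E \<le> (\<Sum>y\<in>?Y. edge_wt A B {x, y})"
    proof (rule sum_star_le)
      fix e assume e: "e \<in> E" "edge_wt A B e \<noteq> 0"
      obtain y where y: "e = {x, y}" "y \<noteq> x" using E[OF e(1)] doubleton_other by metis
      with E[OF e(1)] e(2) 1 have "y \<in> ?Y" by (auto simp: edge_wt_def split: if_splits)
      with y show "e \<in> (\<lambda>y. {x, y}) ` ?Y" by blast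
    qed (use AB edge_wt_nonneg in auto)
    also have "\<dots> = (\<Sum>y\<in>A - {x}. edge_wt A B {x, y}) + (\<Sum>y\<in>B - {v}. edge_wt A B {x, y})"
      using AB by (intro sum.union_disjoint) auto
    also have "\<dots> \<le> (\<Sum>y\<in>A - {x}. 6) + (\<Sum>y\<in>B - {v}. 3)"
    proof (intro add_mono sum_mono)
      fix y assume "y \<in> B - {v}"
      then show "edge_wt A B {x, y} \<le> 3" using edge_wt_le[OF AB(1), of x y] AB by (auto split: if_splits)
    qed (rule edge_wt_le_6)
    finally have "sum (edge_wt A B) E \<le> 6 * int (card (A - {x})) + 3 * int (card (B - {v}))" by simp
    moreover have "int (card (A - {x})) = int (card A) - 1" "int (card (B - {v})) = int (card B) - 1"
      using card_Suc_Diff1[of A x] card_Suc_Diff1[of B v] 1 AB by auto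
    ultimately show ?thesis using 1 by simp
  next
    case 2
    let ?Y = "A \<union> (B - {v, x})"
    have "sum (edge_wt A B) E \<le> (\<Sum>y\<in>?Y. edge_wt A B {x, y})"
    proof (rule sum_star_le)
      fix e assume e: "e \<in> E" "edge_wt A B e \<noteq> 0"
      obtain y where y: "e = {x, y}" "y \<noteq> x" using E[OF e(1)] doubleton_other by metis
      with E[OF e(1)] e(2) 2 have "y \<in> ?Y" by (auto simp: edge_wt_def split: if_splits)
      with y show "e \<in> (\<lambda>y. {x, y}) ` ?Y" by blast
    qed (use AB edge_wt_nonneg in auto)
    also have "\<dots> = (\<Sum>y\<in>A. edge_wt A B {x, y}) + (\<Sum>y\<in>B - {v, x}. edge_wt A B {x, y})"
      using AB by (intro sum.union_disjoint) auto
    also have "\<dots> \<le> (\<Sum>y\<in>A. 3) + (\<Sum>y\<in>B - {v, x}. 2)"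
    proof (intro add_mono sum_mono)
      fix y assume "y \<in> A"
      then show "edge_wt A B {x, y} \<le> 3" using edge_wt_le[OF AB(1), of x y] 2 by (auto split: if_splits)
    next
      fix y assume "y \<in> B - {v, x}"
      then show "edge_wt A B {x, y} \<le> 2" using edge_wt_le[OF AB(1), of x y] AB 2 by (auto split: if_splits)
    qed
    also have "card (B - {v, x}) = card B - 2" using AB 2 by (subst card_Diff_subset) auto
    moreover have "2 \<le> card B" using card_mono[of B "{v, x}"] AB 2 by auto
    ultimately show ?thesis using 2 by (simp add: of_nat_diff)
  next
    case 3
    have "sum (edge_wt A B) E = 0"
    proof (rule sum.neutral, rule ballI)
      fix e assume "e \<in> E"
      with E[of e] 3 AB show "edge_wt A B e = 0" by (auto simp: edge_wt_def)
    qed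
    then show ?thesis using 3 by auto
  qed
qed

lemma cap_le_tie_weight: "cap d \<le> tie_weight d t"
  by (simp add: tie_weight_def)

text \<open>For d > 0 the linear term 6 d + 3 t - 9 is the star centred in A. For d = 0 a star
  weighs at most 2 t - 4, which is at most max 10 (3 t - 11): all three expressions equal 10 at t =
  7.\<close>

lemma edge_wt_star_le_tie_weight:
  assumes AB: "A \<inter> B = {}" "finite A" "finite B" "finite E" "v \<in> B"
    and E: "\<And>e. e \<in> E \<Longrightarrow> card e = 2 \<and> v \<notin> e \<and> x \<in> e"
  shows "sum (edge_wt A B) E \<le> tie_weight (card A) (card B)"
proof -
  have *: "0 \<le> cap (card A)" by (simp add: cap_def)
  have 1: "1 \<le> card A" if "x \<in> A" using that AB by (metis One_nat_def Suc_leI card_gt_0_iff empty_iff)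
  have 2: "2 \<le> card B" if "x \<in> B" "x \<noteq> v" using card_mono[of B "{v, x}"] that AB by auto
  have "(if x \<in> A then 6 * (int (card A) - 1) + 3 * (int (card B) - 1)
     else if x \<in> B \<and> x \<noteq> v then 3 * int (card A) + 2 * (int (card B) - 2) else 0)
     \<le> tie_weight (card A) (card B)"
    using * 1 2 by (auto simp: tie_weight_def cap_def)
  with edge_wt_star[OF assms] show ?thesis by linarith
qed

section \<open>Independent families of pointed triples\<close>

text \<open>With k points of C in B, each of them receives 6 / k.\<close>

lemma edge_wt_shares:
  assumes AB: "A \<inter> B = {}" and C: "card C = 3" "C \<subseteq> A \<union> B" "C \<inter> B \<noteq> {}"
  shows "(\<Sum>v\<in>C \<inter> B. edge_wt A B (C - {v})) = 6"
proof -
  obtain x y z where xyz: "C = {x, y, z}" "x \<noteq> y" "y \<noteq> z" "x \<noteq> z"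
    using C(1) by (auto simp: card_3_iff)
  have "(\<Sum>v\<in>C \<inter> B. edge_wt A B (C - {v})) = (\<Sum>v\<in>C. if v \<in> B then edge_wt A B (C - {v}) else 0)"
    using xyz by (intro sum.inter_restrict) auto
  also have "\<dots> = (if x \<in> B then edge_wt A B {y, z} else 0) + (if y \<in> B then edge_wt A B {x, z} else 0)
      + (if z \<in> B then edge_wt A B {x, y} else 0)"
  proof -
    have "C - {x} = {y, z}" "C - {y} = {x, z}" "C - {z} = {x, y}" using xyz by auto
    then show ?thesis using xyz by simp
  qed
  also have "\<dots> = 6"
  proof -
    have "x \<in> A \<longleftrightarrow> x \<notin> B" "y \<in> A \<longleftrightarrow> y \<notin> B" "z \<in> A \<longleftrightarrow> z \<notin> B" "x \<in> B \<or> y \<in> B \<or> z \<in> B"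
      using AB C xyz by auto
    then show ?thesis by (auto simp: edge_wt_def)
  qed
  finally show ?thesis .
qed

locale pointed_family =
  fixes V :: "'a :: linorder set" and P :: "'a \<Rightarrow> 'a set set"
  assumes finite_V: "finite V"
    and subset: "b \<in> V \<Longrightarrow> C \<in> P b \<Longrightarrow> C \<subseteq> V - {b}"
    and card_3: "b \<in> V \<Longrightarrow> C \<in> P b \<Longrightarrow> card C = 3"
    and cross: "a \<in> V \<Longrightarrow> b \<in> V \<Longrightarrow> C \<in> P a \<Longrightarrow> D \<in> P b \<Longrightarrow> b \<in> C \<Longrightarrow> a \<in> D \<Longrightarrow> C \<inter> D \<noteq> {}"
begin

definition L :: "'a \<Rightarrow> 'a \<Rightarrow> 'a set set" where
  "L b v = {e. v \<notin> e \<and> insert v e \<in> P b}"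

lemma finite_P: "b \<in> V \<Longrightarrow> finite (P b)"
  using subset finite_V by (meson Diff_subset PowI finite_Pow_iff finite_subset subsetI subset_trans)

lemma sum_L: "(\<Sum>C\<in>{C \<in> P b. v \<in> C}. f (C - {v})) = sum f (L b v)"
  by (rule sum.reindex_bij_witness[of _ "insert v" "\<lambda>C. C - {v}"]) (auto simp: L_def insert_absorb)

lemma card_L: "card (L b v) = card {C \<in> P b. v \<in> C}"
  using sum_L[where f = "\<lambda>_. 1 :: nat" and b = b and v = v] by simp

lemma finite_L:
  assumes "b \<in> V"
  shows "finite (L b v)"
proof (rule finite_subset)
  show "finite ((\<lambda>C. C - {v}) ` P b)" using finite_P[OF assms] by simp
  show "L b v \<subseteq> (\<lambda>C. C - {v}) ` P b"
  proof
    fix e assume "e \<in> L b v"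
    then have "e = insert v e - {v}" "insert v e \<in> P b" by (auto simp: L_def)
    then show "e \<in> (\<lambda>C. C - {v}) ` P b" by (rule image_eqI)
  qed
qed

lemma L_edge:
  assumes "b \<in> V" "e \<in> L b v"
  shows "card e = 2" "v \<notin> e" "b \<notin> e" "e \<subseteq> V" "v \<noteq> b"
proof -
  have e: "v \<notin> e" "insert v e \<in> P b" using assms(2) by (auto simp: L_def)
  note s = subset[OF assms(1) e(2)] and c = card_3[OF assms(1) e(2)]
  have "finite (insert v e)" using s finite_V by (meson finite_Diff finite_subset)
  then show "card e = 2" using c e(1) by simp
  show "v \<notin> e" "b \<notin> e" "e \<subseteq> V" "v \<noteq> b" using s e by auto
qed

text \<open>A common point of the triples \<open>insert v e\<close> and \<open>insert b h\<close>
  can be neither v nor b, since h avoids v and e avoids b.\<close>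

lemma L_cross:
  assumes "b \<in> V" "v \<in> V" "e \<in> L b v" "h \<in> L v b"
  shows "e \<inter> h \<noteq> {}"
proof -
  have "insert v e \<inter> insert b h \<noteq> {}"
    using assms by (intro cross[of b v]) (auto simp: L_def)
  then show ?thesis using L_edge[OF assms(1,3)] L_edge[OF assms(2,4)] by auto
qed

text \<open>The order on the points only breaks ties between two links with at most one element.\<close>

definition R :: "'a \<Rightarrow> 'a \<Rightarrow> bool" where
  "R b v \<longleftrightarrow> b \<noteq> v \<and> card (L v b) \<le> 1 \<and> (2 \<le> card (L b v) \<or> b < v)"

lemma asymp_R: "asymp R"
  by (rule asympI) (auto simp: R_def)

definition "Out b = {v \<in> V. R b v}"
definition "In b = {v \<in> V. R v b}"
definition "Tie b = {v \<in> V. v \<noteq> b \<and> \<not> R b v \<and> \<not> R v b}"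

lemma finite_Out: "finite (Out b)" and finite_In: "finite (In b)" and finite_Tie: "finite (Tie b)"
  using finite_V by (auto simp: Out_def In_def Tie_def)

lemma Out_Tie: "Out b \<inter> Tie b = {}"
  by (auto simp: Out_def Tie_def)

lemma V_cases: "v \<in> V \<Longrightarrow> v \<noteq> b \<Longrightarrow> v \<in> Out b \<or> v \<in> In b \<or> v \<in> Tie b"
  by (auto simp: Out_def Tie_def In_def)

lemma Tie_sym: "b \<in> V \<Longrightarrow> v \<in> Tie b \<Longrightarrow> b \<in> Tie v"
  by (auto simp: Tie_def)

lemma Tie_card: "v \<in> Tie b \<Longrightarrow> 2 \<le> card (L b v) \<and> 2 \<le> card (L v b)"
  by (auto simp: Tie_def R_def not_le)

lemma Out_card: "v \<in> Out b \<Longrightarrow> card (L v b) \<le> 1"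
  by (auto simp: Out_def R_def)

abbreviation "wt b \<equiv> edge_wt (Out b) (Tie b)"
abbreviation "deg b \<equiv> card (Out b)"
abbreviation "tdeg b \<equiv> card (Tie b)"

text \<open>A triple at b lies inside \<open>Out b\<close>, or contains a dominating point and is
  counted in the link there, or lies in \<open>Out b \<union> Tie b\<close> and splits its weight 6
  among its tied points.\<close>

lemma card_P_le:
  assumes b: "b \<in> V"
  shows "6 * int (card (P b)) \<le> 6 * int (card {C \<in> P b. C \<subseteq> Out b})
    + 6 * (\<Sum>v\<in>In b. int (card (L b v))) + (\<Sum>v\<in>Tie b. sum (wt b) (L b v))"
proof -
  let ?X = "{C \<in> P b. C \<subseteq> Out b}" and ?Y = "\<Union>v\<in>In b. {C \<in> P b. v \<in> C}"
    and ?Z = "{C \<in> P b. C \<subseteq> Out b \<union> Tie b \<and> C \<inter> Tie b \<noteq> {}}"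
  have fin: "finite (P b)" by (rule finite_P[OF b])
  have "P b \<subseteq> ?X \<union> ?Y \<union> ?Z"
  proof
    fix C assume C: "C \<in> P b"
    have "x \<in> Out b \<or> x \<in> In b \<or> x \<in> Tie b" if "x \<in> C" for x
      using V_cases[of x b] subset[OF b C] that by auto
    with C show "C \<in> ?X \<union> ?Y \<union> ?Z" by blast
  qed
  then have "card (P b) \<le> card (?X \<union> ?Y \<union> ?Z)" using fin finite_In by (intro card_mono) auto
  also have "\<dots> \<le> card ?X + card ?Y + card ?Z"
    using card_Un_le[of "?X \<union> ?Y" ?Z] card_Un_le[of ?X ?Y] by linarith
  finally have 1: "int (card (P b)) \<le> int (card ?X) + int (card ?Y) + int (card ?Z)" by linarith
  have "card ?Y \<le> (\<Sum>v\<in>In b. card {C \<in> P b. v \<in> C})" by (rule card_UN_le[OF finite_In])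
  then have 2: "int (card ?Y) \<le> (\<Sum>v\<in>In b. int (card (L b v)))"
    by (simp add: card_L flip: of_nat_sum)
  have "6 * int (card ?Z) = (\<Sum>C\<in>?Z. \<Sum>v\<in>C \<inter> Tie b. wt b (C - {v}))"
    using card_3[OF b] by (simp add: edge_wt_shares[OF Out_Tie])
  also have "\<dots> = (\<Sum>C\<in>?Z. \<Sum>v\<in>{v \<in> Tie b. v \<in> C}. wt b (C - {v}))"
    by (intro sum.cong refl) auto
  also have "\<dots> = (\<Sum>v\<in>Tie b. \<Sum>C\<in>{C \<in> ?Z. v \<in> C}. wt b (C - {v}))"
    using fin finite_Tie by (intro sum.swap_restrict) auto
  also have "\<dots> \<le> (\<Sum>v\<in>Tie b. \<Sum>C\<in>{C \<in> P b. v \<in> C}. wt b (C - {v}))"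
    using fin edge_wt_nonneg by (intro sum_mono sum_mono2) auto
  finally have 3: "6 * int (card ?Z) \<le> (\<Sum>v\<in>Tie b. sum (wt b) (L b v))" by (simp add: sum_L)
  from 1 2 3 show ?thesis by linarith
qed

lemma card_inner_le: "card {C \<in> P b. C \<subseteq> Out b} \<le> deg b choose 3" if "b \<in> V"
proof -
  have "card {C \<in> P b. C \<subseteq> Out b} \<le> card {C. C \<subseteq> Out b \<and> card C = 3}"
    using finite_Out card_3[OF that] by (intro card_mono) auto
  then show ?thesis using finite_Out by (simp add: n_subsets)
qed

lemma sum_Out_le: "(\<Sum>v\<in>Out b. card (L v b)) \<le> deg b"
  using sum_mono[of "Out b" "\<lambda>v. card (L v b)" "\<lambda>_. 1"] Out_card by simp

text \<open>If \<open>L v b\<close> contains an edge \<open>q\<close>, no triple of \<open>P b\<close> through \<open>v\<close> avoids \<open>q\<close>.\<close>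

lemma card_missing:
  assumes b: "b \<in> V" and v: "v \<in> Out b" "L v b \<noteq> {}" and d: "6 \<le> deg b"
  shows "3 \<le> card {C. C \<subseteq> Out b \<and> card C = 3 \<and> C \<notin> P b \<and> v \<in> C}"
proof -
  obtain q where q: "q \<in> L v b" using v by auto
  have vV: "v \<in> V" using v by (simp add: Out_def)
  have "card q = 2" by (rule L_edge(1)[OF vV q])
  then have "finite q" by (intro card_ge_0_finite) simp
  \<comment> \<open>Six dominated points leave three outside \<open>{v} \<union> q\<close>; the
    three pairs among these, each joined with v, are the missing triples.\<close>
  have "card ({v} \<union> q) \<le> 3" using card_Un_le[of "{v}" q] \<open>card q = 2\<close> by simp
  then have "3 \<le> card (Out b - ({v} \<union> q))"
    using diff_card_le_card_Diff[of "{v} \<union> q" "Out b"] \<open>finite q\<close> d by simp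
  then obtain Q where Q: "Q \<subseteq> Out b - ({v} \<union> q)" "card Q = 3" by (meson obtain_subset_with_card_n)
  then have finQ: "finite Q" by (intro card_ge_0_finite) simp
  have three: "card {e. e \<subseteq> Q \<and> card e = 2} = 3"
    using n_subsets[OF finQ, of 2] Q by (simp add: numeral_eq_Suc)
  have "card {e. e \<subseteq> Q \<and> card e = 2} = card (insert v ` {e. e \<subseteq> Q \<and> card e = 2})"
    using Q by (intro card_image[symmetric]) (auto simp: inj_on_def)
  also have "\<dots> \<le> card {C. C \<subseteq> Out b \<and> card C = 3 \<and> C \<notin> P b \<and> v \<in> C}"
  proof (rule card_mono)
    show "finite {C. C \<subseteq> Out b \<and> card C = 3 \<and> C \<notin> P b \<and> v \<in> C}"
      using finite_Out[of b] by auto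
    show "insert v ` {e. e \<subseteq> Q \<and> card e = 2} \<subseteq> {C. C \<subseteq> Out b \<and> card C = 3 \<and> C \<notin> P b \<and> v \<in> C}"
    proof
      fix C assume "C \<in> insert v ` {e. e \<subseteq> Q \<and> card e = 2}"
      then obtain e where e: "C = insert v e" "e \<subseteq> Q" "card e = 2" by auto
      have ve: "v \<notin> e" using e Q by auto
      have "finite e" using e finQ by (meson finite_subset)
      then have "card C = 3" using e ve by simp
      moreover have "C \<notin> P b"
      proof
        assume "C \<in> P b"
        then have "e \<in> L b v" using e ve by (simp add: L_def)
        with L_cross[OF b vV _ q] have "e \<inter> q \<noteq> {}" by blast
        then show False using e Q by auto
      qed
      ultimately show "C \<in> {C. C \<subseteq> Out b \<and> card C = 3 \<and> C \<notin> P b \<and> v \<in> C}"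
        using e Q v by auto
    qed
  qed
  finally show ?thesis using three by simp
qed

text \<open>Double counting: each v with a nonempty link \<open>L v b\<close> forces three missing
  triples through v, and a triple is counted for at most three such v. So the missing triples
  compensate for the one-edge links, which is why \<open>extra\<close> vanishes from d = 6
  on.\<close>

lemma inner_plus_single_le:
  assumes b: "b \<in> V" and d: "6 \<le> deg b"
  shows "card {C \<in> P b. C \<subseteq> Out b} + (\<Sum>v\<in>Out b. card (L v b)) \<le> deg b choose 3"
proof -
  let ?K = "{v \<in> Out b. L v b \<noteq> {}}" and ?M = "{C. C \<subseteq> Out b \<and> card C = 3 \<and> C \<notin> P b}"
    and ?X = "{C \<in> P b. C \<subseteq> Out b}"
  have finM: "finite ?M" using finite_Out[of b] by auto
  have "(\<Sum>v\<in>Out b. card (L v b)) \<le> (\<Sum>v\<in>Out b. if L v b \<noteq> {} then 1 else 0)"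
    using Out_card by (intro sum_mono) auto
  also have "\<dots> = card ?K" using finite_Out by (simp flip: sum.inter_filter)
  finally have k: "(\<Sum>v\<in>Out b. card (L v b)) \<le> card ?K" .
  have "card ?K * 3 = (\<Sum>v\<in>?K. 3)" by simp
  also have "\<dots> \<le> (\<Sum>v\<in>?K. card {C \<in> ?M. v \<in> C})"
  proof (rule sum_mono)
    fix v assume "v \<in> ?K"
    moreover have "{C \<in> ?M. v \<in> C} = {C. C \<subseteq> Out b \<and> card C = 3 \<and> C \<notin> P b \<and> v \<in> C}" by auto
    ultimately show "3 \<le> card {C \<in> ?M. v \<in> C}" using card_missing[OF b _ _ d] by simp
  qed
  also have "\<dots> = (\<Sum>v\<in>?K. \<Sum>C\<in>{C \<in> ?M. v \<in> C}. 1)" by simp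
  also have "\<dots> = (\<Sum>C\<in>?M. \<Sum>v\<in>{v \<in> ?K. v \<in> C}. 1)"
    using finM finite_Out by (intro sum.swap_restrict) auto
  also have "\<dots> \<le> (\<Sum>C\<in>?M. 3)"
  proof (rule sum_mono)
    fix C assume "C \<in> ?M"
    then have "card C = 3" "finite C" by (auto intro: card_ge_0_finite)
    then have "card {v \<in> ?K. v \<in> C} \<le> 3" using card_mono[of C "{v \<in> ?K. v \<in> C}"] by auto
    then show "(\<Sum>v\<in>{v \<in> ?K. v \<in> C}. 1) \<le> (3::nat)" by simp
  qed
  finally have "card ?K \<le> card ?M" by simp
  moreover have "card ?X + card ?M = deg b choose 3"
  proof -
    have "{C. C \<subseteq> Out b \<and> card C = 3} = ?X \<union> ?M" using card_3[OF b] by auto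
    moreover have "card (?X \<union> ?M) = card ?X + card ?M"
      using finM finite_P[OF b] by (intro card_Un_disjoint) auto
    ultimately show ?thesis using n_subsets[OF finite_Out, of b 3] by simp
  qed
  ultimately show ?thesis using k by linarith
qed

section \<open>Allowances along ties\<close>

lemma edge_weight_L:
  assumes b: "b \<in> V" and "cap (deg b) \<le> S" "\<And>x. sum (wt b) {e \<in> L b v. x \<in> e} \<le> S"
  shows "edge_weight (L b v) (wt b) (cap (deg b)) S"
proof (rule edge_weight.intro)
  show "finite (L b v)" by (rule finite_L[OF b])
  show "card e = 2" if "e \<in> L b v" for e by (rule L_edge(1)[OF b that])
  show "0 \<le> wt b e" "wt b e \<le> 6" for e by (rule edge_wt_nonneg, rule edge_wt_le_6)
qed (use assms edge_wt_quad[OF Out_Tie finite_Out] edge_wt_triangle[OF Out_Tie finite_Out]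
    edge_wt_cherry[OF Out_Tie finite_Out] in blast)+

text \<open>If \<open>b\<close> dominates a single point \<open>z\<close> and \<open>q \<in> L z b\<close>, then the star centred at \<open>z\<close> has at most two
  edges in \<open>L b v\<close> for every \<open>v \<notin> q\<close>. The resulting saving pays for \<open>q\<close>, which \<open>\<psi>\<close> does not cover
  for \<open>d = 1\<close>, \<open>t \<ge> 7\<close>.\<close>

definition special :: "'a \<Rightarrow> 'a \<Rightarrow> bool" where
  "special b v \<longleftrightarrow> deg b = 1 \<and> 7 \<le> tdeg b \<and> (\<exists>z\<in>Out b. \<exists>q\<in>L z b. v \<notin> q)"

definition allowance :: "'a \<Rightarrow> 'a \<Rightarrow> int" where
  "allowance b v = tie_weight (deg b) (tdeg b) - (if special b v then 3 else 0)"

text \<open>In the special case the allowance is 3 t - 6 with t \<ge> 7. It exceeds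
  \<open>cap 1\<close> = 12, the bound 6 for the star at z and the bound 2 t - 1 for any other
  star.\<close>

lemma edge_weight_allowance:
  assumes b: "b \<in> V" and v: "v \<in> Tie b"
  shows "edge_weight (L b v) (wt b) (cap (deg b)) (allowance b v)"
proof (cases "special b v")
  case False
  have "sum (wt b) {e \<in> L b v. x \<in> e} \<le> tie_weight (deg b) (tdeg b)" for x
    using finite_L[OF b] L_edge[OF b] v
    by (intro edge_wt_star_le_tie_weight[OF Out_Tie finite_Out finite_Tie]) auto
  then show ?thesis using False cap_le_tie_weight by (intro edge_weight_L[OF b]) (auto simp: allowance_def)
next
  case True
  then obtain z q where zq: "deg b = 1" "7 \<le> tdeg b" "z \<in> Out b" "q \<in> L z b" "v \<notin> q"
    by (auto simp: special_def)
  have z: "Out b = {z}" using zq(1,3) by (auto simp: card_1_singleton_iff)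
  have zV: "z \<in> V" using zq(3) by (simp add: Out_def)
  have al: "allowance b v = 3 * int (tdeg b) - 6"
    using True zq by (simp add: allowance_def tie_weight_def cap_def)
  have "sum (wt b) {e \<in> L b v. x \<in> e} \<le> allowance b v" for x
  proof (cases "x = z")
    case False
    have "sum (wt b) {e \<in> L b v. x \<in> e} \<le> (if x \<in> Out b then 6 * (int (deg b) - 1) + 3 * (int (tdeg b) - 1)
     else if x \<in> Tie b \<and> x \<noteq> v then 3 * int (deg b) + 2 * (int (tdeg b) - 2) else 0)"
      using finite_L[OF b] L_edge[OF b] v
      by (intro edge_wt_star[OF Out_Tie finite_Out finite_Tie]) auto
    also have "\<dots> \<le> allowance b v" using False z zq al by auto
    finally show ?thesis .
  next
    case True
    have vz: "v \<noteq> z" "v \<in> V" using v z Out_Tie[of b] by (auto simp: Tie_def)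
    obtain x0 y0 where q: "q = {x0, y0}" using L_edge(1)[OF zV zq(4)] by (auto simp: card_2_iff)
    have "{e \<in> L b v. z \<in> e} \<subseteq> {{z, x0}, {z, y0}}"
    proof
      fix e assume "e \<in> {e \<in> L b v. z \<in> e}"
      then have e: "e \<in> L b v" "z \<in> e" by auto
      obtain y where y: "e = {z, y}" "y \<noteq> z" using L_edge(1)[OF b e(1)] e(2) by (rule doubleton_other)
      have "v \<noteq> y" using L_edge(2)[OF b e(1)] y by auto
      moreover have "insert z {v, y} \<in> P b" using e y by (simp add: L_def insert_commute)
      ultimately have "{v, y} \<in> L b z" using y vz by (simp add: L_def)
      with L_cross[OF b zV _ zq(4)] have "{v, y} \<inter> q \<noteq> {}" by blast
      then have "y \<in> q" using zq(5) by auto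
      then show "e \<in> {{z, x0}, {z, y0}}" using y q by auto
    qed
    then have "sum (wt b) {e \<in> L b v. z \<in> e} \<le> sum (wt b) {{z, x0}, {z, y0}}"
      using edge_wt_nonneg by (intro sum_mono2) auto
    \<comment> \<open>The endpoints \<open>x0\<close> and \<open>y0\<close> lie outside
      \<open>Out b\<close>, so two distinct edges carry at most 3 each; a single edge carries at
      most 6.\<close>
    also have "\<dots> \<le> 6"
    proof (cases "{z, x0} = {z, y0}")
      case True
      then show ?thesis by (simp add: edge_wt_le_6)
    next
      case False
      have "z \<notin> q" 
        using L_edge(3)[OF zV zq(4)] by simp
      then have "wt b {z, x0} \<le> 3" "wt b {z, y0} \<le> 3"
        using edge_wt_le[OF Out_Tie, of b z x0] edge_wt_le[OF Out_Tie, of b z y0] z q by auto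
      then show ?thesis using False by simp
    qed
    finally show ?thesis using True zq al by simp
  qed
  then show ?thesis using zq al by (intro edge_weight_L[OF b]) (auto simp: cap_def)
qed

lemma sum_tie_le:
  assumes "b \<in> V" "v \<in> Tie b"
  shows "sum (wt b) (L b v) + sum (wt v) (L v b) \<le> allowance b v + allowance v b"
proof -
  have "v \<in> V" using assms by (simp add: Tie_def)
  show ?thesis
    by (rule cross_le[OF edge_weight_allowance[OF assms] edge_weight_allowance[OF \<open>v \<in> V\<close> Tie_sym[OF assms]]
          L_cross[OF assms(1) \<open>v \<in> V\<close>]])
      (use Tie_card[OF assms(2)] in auto)
qed

lemma sum_Tie_swap: "(\<Sum>b\<in>V. \<Sum>v\<in>Tie b. f b v) = (\<Sum>b\<in>V. \<Sum>v\<in>Tie b. f v b)"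
proof -
  have "(\<Sum>b\<in>V. \<Sum>v\<in>Tie b. f b v) = (\<Sum>b\<in>V. \<Sum>v\<in>{v \<in> V. v \<in> Tie b}. f b v)"
    by (intro sum.cong) (auto simp: Tie_def)
  also have "\<dots> = (\<Sum>v\<in>V. \<Sum>b\<in>{b \<in> V. v \<in> Tie b}. f b v)"
    using finite_V by (intro sum.swap_restrict)
  also have "\<dots> = (\<Sum>b\<in>V. \<Sum>v\<in>Tie b. f v b)"
    by (intro sum.cong) (auto simp: Tie_def)
  finally show ?thesis .
qed

lemma sum_In_Out: "(\<Sum>b\<in>V. \<Sum>v\<in>In b. f b v) = (\<Sum>b\<in>V. \<Sum>v\<in>Out b. f v b)"
  unfolding In_def Out_def using finite_V by (intro sum.swap_restrict)

text \<open>The estimate is available only for the two links of a tie together, so the sum is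
  doubled and its terms are paired using the symmetry of ties.\<close>

lemma sum_wt_le_sum_allowance:
  "(\<Sum>b\<in>V. \<Sum>v\<in>Tie b. sum (wt b) (L b v)) \<le> (\<Sum>b\<in>V. \<Sum>v\<in>Tie b. allowance b v)"
proof -
  have "2 * (\<Sum>b\<in>V. \<Sum>v\<in>Tie b. sum (wt b) (L b v))
      = (\<Sum>b\<in>V. \<Sum>v\<in>Tie b. sum (wt b) (L b v) + sum (wt v) (L v b))"
    using sum_Tie_swap[of "\<lambda>b v. sum (wt b) (L b v)"] by (simp add: sum.distrib)
  also have "\<dots> \<le> (\<Sum>b\<in>V. \<Sum>v\<in>Tie b. allowance b v + allowance v b)"
    by (intro sum_mono sum_tie_le)
  also have "\<dots> = 2 * (\<Sum>b\<in>V. \<Sum>v\<in>Tie b. allowance b v)"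
    using sum_Tie_swap[of allowance] by (simp add: sum.distrib)
  finally show ?thesis by simp
qed

text \<open>The one-edge links at dominated points are paid for in three ways: by the savings at
  special points if d = 1 and t \<ge> 7, by missing triples if d \<ge> 6, and by
  \<open>extra\<close> otherwise.\<close>

lemma vertex_bound:
  assumes b: "b \<in> V"
  shows "6 * int (card {C \<in> P b. C \<subseteq> Out b}) + 6 * (\<Sum>v\<in>Out b. int (card (L v b)))
    + (\<Sum>v\<in>Tie b. allowance b v) \<le> \<psi> (deg b) (tdeg b)"
proof -
  let ?d = "deg b" and ?t = "tdeg b"
  let ?X = "card {C \<in> P b. C \<subseteq> Out b}" and ?k = "\<Sum>v\<in>Out b. card (L v b)"
  have X: "6 * int ?X \<le> int ?d * (int ?d - 1) * (int ?d - 2)"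
    using card_inner_le[OF b] int_choose_3[of ?d] by linarith
  have k: "?k \<le> ?d" by (rule sum_Out_le)
  have A: "(\<Sum>v\<in>Tie b. allowance b v) = int ?t * tie_weight ?d ?t - 3 * int (card {v \<in> Tie b. special b v})"
  proof -
    have "(\<Sum>v\<in>Tie b. if special b v then 3 else 0) = 3 * int (card {v \<in> Tie b. special b v})"
      using finite_Tie by (simp flip: sum.inter_filter)
    then show ?thesis by (simp add: allowance_def sum_subtractf)
  qed
  have "6 * int ?X + 6 * int ?k \<le> int ?d * (int ?d - 1) * (int ?d - 2) + extra ?d ?t
      + 3 * int (card {v \<in> Tie b. special b v})"
  proof (cases "?d = 1 \<and> 7 \<le> ?t")
    case True
    then obtain z where z: "Out b = {z}" by (auto simp: card_1_singleton_iff)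
    then have zV: "z \<in> V" by (auto simp: Out_def)
    show ?thesis
    proof (cases "L z b = {}")
      case True
      then have "?k = 0" using z by simp
      moreover have "int ?d * (int ?d - 1) * (int ?d - 2) = 0" using \<open>?d = 1 \<and> 7 \<le> ?t\<close> by simp
      moreover have "0 \<le> extra ?d ?t" by (simp add: extra_def)
      ultimately show ?thesis using X by linarith
    next
      case False
      then obtain q where q: "q \<in> L z b" by auto
      have q2: "card q = 2" by (rule L_edge(1)[OF zV q])
      then have finq: "finite q" by (intro card_ge_0_finite) simp
      have "card (Tie b - q) \<le> card {v \<in> Tie b. special b v}"
        using finite_Tie True z q by (intro card_mono) (auto simp: special_def)
      moreover have "?t - 2 \<le> card (Tie b - q)"
        using diff_card_le_card_Diff[OF finq, of "Tie b"] q2 by simp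
      \<comment> \<open>Five special points save 15, more than the weight 6 of the one edge
        q.\<close>
      ultimately have "5 \<le> card {v \<in> Tie b. special b v}" using True by linarith
      moreover have "int ?k \<le> 1" using k True by linarith
      moreover have "int ?d * (int ?d - 1) * (int ?d - 2) = 0" using True by simp
      moreover have "0 \<le> extra ?d ?t" by (simp add: extra_def)
      ultimately show ?thesis using X by linarith
    qed
  next
    case False
    show ?thesis
    proof (cases "6 \<le> ?d")
      case True
      then have "extra ?d ?t = 0" by (simp add: extra_def)
      moreover have "?X + ?k \<le> ?d choose 3" by (rule inner_plus_single_le[OF b True])
      ultimately show ?thesis using int_choose_3[of ?d] by linarith
    next
      case False
      with \<open>\<not> (?d = 1 \<and> 7 \<le> ?t)\<close> have "extra ?d ?t = 6 * int ?d" by (auto simp: extra_def)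
      then show ?thesis using X k by linarith
    qed
  qed
  with A show ?thesis by (simp add: \<psi>_def)
qed

lemma sum_card_P_le:
  assumes "7 \<le> card V"
  shows "(\<Sum>b\<in>V. card (P b)) \<le> (card V choose 4) + 42"
proof -
  have "6 * int (\<Sum>b\<in>V. card (P b)) = (\<Sum>b\<in>V. 6 * int (card (P b)))" by (simp add: sum_distrib_left)
  also have "\<dots> \<le> (\<Sum>b\<in>V. 6 * int (card {C \<in> P b. C \<subseteq> Out b})
    + 6 * (\<Sum>v\<in>In b. int (card (L b v))) + (\<Sum>v\<in>Tie b. sum (wt b) (L b v)))"
    by (intro sum_mono card_P_le)
  also have "\<dots> = (\<Sum>b\<in>V. 6 * int (card {C \<in> P b. C \<subseteq> Out b}))
    + 6 * (\<Sum>b\<in>V. \<Sum>v\<in>In b. int (card (L b v))) + (\<Sum>b\<in>V. \<Sum>v\<in>Tie b. sum (wt b) (L b v))"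
    by (simp add: sum.distrib sum_distrib_left)
  \<comment> \<open>Triples through a dominating point are now charged to that point instead of
    their own base point.\<close>
  also have "(\<Sum>b\<in>V. \<Sum>v\<in>In b. int (card (L b v))) = (\<Sum>b\<in>V. \<Sum>v\<in>Out b. int (card (L v b)))"
    by (rule sum_In_Out)
  also have "(\<Sum>b\<in>V. 6 * int (card {C \<in> P b. C \<subseteq> Out b}))
    + 6 * (\<Sum>b\<in>V. \<Sum>v\<in>Out b. int (card (L v b))) + (\<Sum>b\<in>V. \<Sum>v\<in>Tie b. sum (wt b) (L b v))
    \<le> (\<Sum>b\<in>V. 6 * int (card {C \<in> P b. C \<subseteq> Out b}))
    + 6 * (\<Sum>b\<in>V. \<Sum>v\<in>Out b. int (card (L v b))) + (\<Sum>b\<in>V. \<Sum>v\<in>Tie b. allowance b v)"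
    by (intro add_mono order_refl sum_wt_le_sum_allowance)
  also have "\<dots> = (\<Sum>b\<in>V. 6 * int (card {C \<in> P b. C \<subseteq> Out b})
    + 6 * (\<Sum>v\<in>Out b. int (card (L v b))) + (\<Sum>v\<in>Tie b. allowance b v))"
    by (simp add: sum.distrib sum_distrib_left)
  also have "\<dots> \<le> (\<Sum>b\<in>V. \<psi> (deg b) (tdeg b))" by (intro sum_mono vertex_bound)
  also have "\<dots> = (\<Sum>b\<in>V. \<psi> (outs V R b) (ties V R b))"
    by (simp add: outs_def ties_def Out_def Tie_def)
  also have "\<dots> \<le> 6 * int ((card V choose 4) + 42)"
    by (rule sum_\<psi>_le[OF finite_V asymp_R assms])
  finally show ?thesis
    by (simp only: mult_le_cancel_left_pos zero_less_numeral of_nat_le_iff)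
qed

end

section \<open>Flags\<close>

definition pointed :: "nat \<Rightarrow> (nat \<times> nat set) set" where
  "pointed n = {(a, C). a \<in> {1..n} \<and> C \<subseteq> {1..n} - {a} \<and> card C = 3}"

definition to_flag :: "nat \<Rightarrow> nat \<times> nat set \<Rightarrow> nat set set" where
  "to_flag n p = {{fst p}, {1..n} - snd p}"

lemma pointedD:
  assumes "(a, C) \<in> pointed n"
  shows "1 \<le> a" "a \<le> n" "a \<notin> C" "C \<subseteq> {1..n}" "card C = 3" "finite C" "card ({1..n} - C) = n - 3"
proof -
  show *: "1 \<le> a" "a \<le> n" "a \<notin> C" "C \<subseteq> {1..n}" "card C = 3" using assms by (auto simp: pointed_def)
  show "finite C" using *(4) by (rule finite_subset) simp
  then show "card ({1..n} - C) = n - 3" using * by (simp add: card_Diff_subset)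
qed

lemma finite_pointed: "finite (pointed n)"
proof (rule finite_subset)
  show "pointed n \<subseteq> {1..n} \<times> Pow {1..n}" by (auto simp: pointed_def)
qed simp

lemma to_flag_inj_on:
  assumes "n \<ge> 9"
  shows "inj_on (to_flag n) (pointed n)"
proof (rule inj_onI)
  fix p q assume pq: "p \<in> pointed n" "q \<in> pointed n" "to_flag n p = to_flag n q"
  obtain a C b D where p: "p = (a, C)" and q: "q = (b, D)" by fastforce
  note a = pointedD[OF pq(1)[unfolded p]] and b = pointedD[OF pq(2)[unfolded q]]
  have "{a} \<noteq> {1..n} - D"
  proof
    assume "{a} = {1..n} - D"
    then have "card {a} = n - 3" using b(7) by simp
    then show False using assms by simp
  qed
  then have "{a} = {b}" "{1..n} - C = {1..n} - D"
    using pq(3) by (auto simp: to_flag_def p q doubleton_eq_iff)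
  moreover from this(2) have "C = D" using a(4) b(4) by blast
  ultimately show "p = q" by (simp add: p q)
qed

lemma to_flag_vertex:
  assumes "n \<ge> 9" "p \<in> pointed n"
  shows "to_flag n p \<in> Gamma_vertices n 1 (n - 3)"
proof -
  obtain a C where p: "p = (a, C)" by fastforce
  note a = pointedD[OF assms(2)[unfolded p]]
  have "{1..n} - C \<noteq> {}"
  proof
    assume eq: "{1..n} - C = {}"
    show False using a(7) assms(1) unfolding eq by simp
  qed
  have "C \<noteq> {}" using a(5) by auto
  have "{a} \<noteq> {1..n}"
  proof
    assume "{a} = {1..n}"
    then have "card {a} = n" by simp
    then show False using assms(1) by simp
  qed
  show ?thesis
    using a \<open>{1..n} - C \<noteq> {}\<close> \<open>C \<noteq> {}\<close> \<open>{a} \<noteq> {1..n}\<close>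
    by (auto simp: Gamma_vertices_def flag_def flag_type_def chain_subset_def to_flag_def p)
qed

text \<open>A chain of finite sets has at most one member of each size, so the type determines that
  the flag consists of one singleton and one set of size n - 3.\<close>

lemma vertex_to_flag:
  assumes "n \<ge> 9" "f \<in> Gamma_vertices n 1 (n - 3)"
  shows "f \<in> to_flag n ` pointed n"
proof -
  have f: "\<And>X. X \<in> f \<Longrightarrow> X \<noteq> {} \<and> X \<subset> {1..n}" "chain\<^sub>\<subseteq> f" "card ` f = {1, n - 3}"
    using assms(2) by (auto simp: Gamma_vertices_def flag_def flag_type_def)
  have fin: "finite X" if "X \<in> f" for X 
    by (rule finite_subset[of _ "{1..n}"]) (use f(1)[OF that] in auto)
  have same: "X = Y" if XY: "X \<in> f" "Y \<in> f" "card X = card Y" for X Y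
  proof -
    have "X \<subseteq> Y \<or> Y \<subseteq> X" using f(2) XY by (auto simp: chain_subset_def)
    then show ?thesis
      using card_subset_eq[OF fin[OF XY(1)], of Y] card_subset_eq[OF fin[OF XY(2)], of X] XY(3) by auto
  qed
  have "1 \<in> card ` f" "n - 3 \<in> card ` f" using f(3) by auto
  then obtain X Y where X: "X \<in> f" "card X = 1" and Y: "Y \<in> f" "card Y = n - 3" by auto
  have "f = {X, Y}"
  proof
    show "f \<subseteq> {X, Y}"
    proof
      fix Z assume Z: "Z \<in> f"
      then have "card Z = 1 \<or> card Z = n - 3" using f(3) by blast
      then show "Z \<in> {X, Y}" using same[OF Z X(1)] same[OF Z Y(1)] X(2) Y(2) by auto
    qed
  qed (use X Y in auto)
  obtain a where a: "X = {a}" using X(2) by (auto simp: card_1_singleton_iff)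
  have "\<not> Y \<subseteq> X" using card_mono[OF fin[OF X(1)], of Y] X(2) Y(2) assms(1) by auto
  then have aY: "a \<in> Y" using f(2) X(1) Y(1) a by (auto simp: chain_subset_def)
  have YV: "Y \<subseteq> {1..n}" using f(1)[OF Y(1)] by auto
  have "card ({1..n} - Y) = 3"
    using card_Diff_subset[OF fin[OF Y(1)] YV] Y(2) assms(1) by simp
  then have "(a, {1..n} - Y) \<in> pointed n" using aY YV by (auto simp: pointed_def)
  moreover have "{1..n} - ({1..n} - Y) = Y" using YV by auto
  then have "f = to_flag n (a, {1..n} - Y)"
    using \<open>f = {X, Y}\<close> a by (simp add: to_flag_def)
  ultimately show ?thesis by blast
qed

lemma Gamma_vertices_eq: "n \<ge> 9 \<Longrightarrow> Gamma_vertices n 1 (n - 3) = to_flag n ` pointed n"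
  using to_flag_vertex vertex_to_flag by auto

text \<open>For n \<ge> 9 sizes rule out one alternative of oppositeness in each pair: a singleton
  with either kind of set cannot cover \<open>{1..n}\<close>, and the two large sets meet because C
  and D have at most 6 points together.\<close>

lemma opposite_to_flag:
  assumes n: "n \<ge> 9" and p: "(a, C) \<in> pointed n" and q: "(b, D) \<in> pointed n"
  shows "opposite_flags n (to_flag n (a, C)) (to_flag n (b, D)) \<longleftrightarrow> C \<inter> D = {} \<and> a \<in> D \<and> b \<in> C"
proof -
  note a = pointedD[OF p] and b = pointedD[OF q]
  have 1: "insert x ({1..n} - E) \<noteq> {1..n}" if E: "(x', E) \<in> pointed n" for x x' E
  proof
    assume eq: "insert x ({1..n} - E) = {1..n}"
    have "card (insert x ({1..n} - E)) \<le> Suc (card ({1..n} - E))" by (simp add: card_insert_if)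
    also have "\<dots> = Suc (n - 3)" using pointedD(7)[OF E] by simp
    finally show False using n unfolding eq by simp
  qed
  have 2: "{a, b} \<noteq> {1..n}"
  proof
    assume "{a, b} = {1..n}"
    then have "n \<le> card {a, b}" by simp
    also have "\<dots> \<le> 2" by (simp add: card_insert_if)
    finally show False using n by simp
  qed
  have 3: "({1..n} - C) \<inter> ({1..n} - D) \<noteq> {}"
  proof
    assume "({1..n} - C) \<inter> ({1..n} - D) = {}"
    then have "{1..n} \<subseteq> C \<union> D" by auto
    then have "n \<le> card (C \<union> D)" using card_mono[of "C \<union> D" "{1..n}"] a(6) b(6) by simp
    also have "\<dots> \<le> 6" using card_Un_le[of C D] a(5) b(5) by simp
    finally show False using n by simp
  qed
  have "opposite_sets n {a} {b} \<longleftrightarrow> a \<noteq> b" using 2 by (auto simp: opposite_sets_def)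
  moreover have "opposite_sets n {a} ({1..n} - D) \<longleftrightarrow> a \<in> D"
    using 1[OF q, of a] a by (auto simp: opposite_sets_def)
  moreover have "opposite_sets n ({1..n} - C) {b} \<longleftrightarrow> b \<in> C"
    using 1[OF p, of b] b by (auto simp: opposite_sets_def)
  moreover have "opposite_sets n ({1..n} - C) ({1..n} - D) \<longleftrightarrow> C \<inter> D = {}"
    using 3 a(4) b(4) by (auto simp: opposite_sets_def)
  ultimately show ?thesis using a(3) by (auto simp: opposite_flags_def to_flag_def)
qed

lemma independent_to_flag_iff:
  assumes n: "n \<ge> 9" and A: "A \<subseteq> pointed n"
  shows "independent_set (Gamma n 1 (n - 3)) (to_flag n ` A)
    \<longleftrightarrow> (\<forall>(a, C)\<in>A. \<forall>(b, D)\<in>A. b \<in> C \<longrightarrow> a \<in> D \<longrightarrow> C \<inter> D \<noteq> {})"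
proof -
  have sym: "opposite_flags n f g \<longleftrightarrow> opposite_flags n g f" for f g
    unfolding opposite_flags_def opposite_sets_def by (metis Int_commute Un_commute)
  have edge: "{to_flag n p, to_flag n q} \<in> snd (Gamma n 1 (n - 3)) \<longleftrightarrow> opposite_flags n (to_flag n p) (to_flag n q)"
    if "p \<in> A" "q \<in> A" for p q
  proof -
    have "to_flag n p \<in> Gamma_vertices n 1 (n - 3)" "to_flag n q \<in> Gamma_vertices n 1 (n - 3)"
      using that A by (auto intro!: to_flag_vertex[OF n] simp del: One_nat_def)
    then show ?thesis using sym by (auto simp: Gamma_def doubleton_eq_iff)
  qed
  have inj: "to_flag n p = to_flag n q \<longleftrightarrow> p = q" if "p \<in> A" "q \<in> A" for p q
    using to_flag_inj_on[OF n] A that by (auto dest: inj_onD)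
  have fst_Gamma: "fst (Gamma n 1 (n - 3)) = Gamma_vertices n 1 (n - 3)" by (simp add: Gamma_def)
  have "to_flag n ` A \<subseteq> Gamma_vertices n 1 (n - 3)"
    using A Gamma_vertices_eq[OF n] by auto
  then have "independent_set (Gamma n 1 (n - 3)) (to_flag n ` A)
    \<longleftrightarrow> (\<forall>p\<in>A. \<forall>q\<in>A. p \<noteq> q \<longrightarrow> \<not> opposite_flags n (to_flag n p) (to_flag n q))"
    using edge inj fst_Gamma by (simp add: independent_set_def pairwise_def)
  also have "\<dots> \<longleftrightarrow> (\<forall>(a, C)\<in>A. \<forall>(b, D)\<in>A. b \<in> C \<longrightarrow> a \<in> D \<longrightarrow> C \<inter> D \<noteq> {})"
  proof -
    \<comment> \<open>For p = q the right side is vacuous, as the point of a pair is not in its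
      triple.\<close>
    have "(p \<noteq> q \<longrightarrow> \<not> opposite_flags n (to_flag n p) (to_flag n q)) \<longleftrightarrow>
       (fst q \<in> snd p \<longrightarrow> fst p \<in> snd q \<longrightarrow> snd p \<inter> snd q \<noteq> {})" if pq: "p \<in> A" "q \<in> A" for p q
    proof -
      have "(fst p, snd p) \<in> pointed n" "(fst q, snd q) \<in> pointed n" using pq A by auto
      from opposite_to_flag[OF n this] pointedD(3)[OF this(1)] show ?thesis by auto
    qed
    then show ?thesis by (simp add: case_prod_beta cong: ball_cong)
  qed
  finally show ?thesis .
qed

lemma independent_card_le:
  assumes n: "n \<ge> 9" and S: "independent_set (Gamma n 1 (n - 3)) S"
  shows "card S \<le> (n choose 4) + 42"
proof -
  define P where "P b = {C. (b, C) \<in> pointed n \<and> to_flag n (b, C) \<in> S}" for b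
  define A where "A = (SIGMA b:{1..n}. P b)"
  have A: "A = {p \<in> pointed n. to_flag n p \<in> S}" by (auto simp: A_def P_def pointed_def)
  have "S \<subseteq> to_flag n ` pointed n"
    using S Gamma_vertices_eq[OF n] by (simp add: independent_set_def Gamma_def)
  then have SA: "S = to_flag n ` A" by (auto simp: A)
  have AS: "A \<subseteq> pointed n" by (auto simp: A)
  have cr: "\<forall>(a, C)\<in>A. \<forall>(b, D)\<in>A. b \<in> C \<longrightarrow> a \<in> D \<longrightarrow> C \<inter> D \<noteq> {}"
    using S independent_to_flag_iff[OF n AS] SA by simp
  interpret pointed_family "{1..n}" P
  proof
    show "C \<subseteq> {1..n} - {b}" "card C = 3" if "C \<in> P b" for b C
      using that by (auto simp: P_def pointed_def)
    show "C \<inter> D \<noteq> {}" if "a \<in> {1..n}" "b \<in> {1..n}" "C \<in> P a" "D \<in> P b" "b \<in> C" "a \<in> D" for a b C D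
    proof -
      have "(a, C) \<in> A" "(b, D) \<in> A" using that by (auto simp: A_def)
      then show ?thesis using cr that by blast
    qed
  qed simp
  have "card S = card A"
    unfolding SA using to_flag_inj_on[OF n] AS by (intro card_image) (rule inj_on_subset)
  also have "\<dots> = (\<Sum>b\<in>{1..n}. card (P b))"
    unfolding A_def using finite_P by (intro card_SigmaI) auto
  also have "\<dots> \<le> (n choose 4) + 42" using sum_card_P_le n by simp
  finally show ?thesis .
qed

section \<open>The extremal family\<close>

definition extremal :: "nat \<Rightarrow> nat set set" where
  "extremal a = (if 10 \<le> a then {C. C \<subseteq> {1..<a} \<and> card C = 3}
    else if 2 \<le> a then {C. C \<subseteq> {1..9} - {a} \<and> 1 \<in> C \<and> card C = 3} else {})"

text \<open>Triples at a point from 10 on lie below it, and triples at smaller points stay below 10.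
  Mutual containment thus forces both points below 10, where all triples share 1.\<close>

lemma extremal_cross:
  assumes "C \<in> extremal a" "D \<in> extremal b" "b \<in> C" "a \<in> D"
  shows "C \<inter> D \<noteq> {}"
proof -
  have less: "y < x" if "E \<in> extremal x" "10 \<le> x" "y \<in> E" for E x y
    using that by (auto simp: extremal_def)
  have small: "1 \<in> E \<and> y < 10" if "E \<in> extremal x" "\<not> 10 \<le> x" "y \<in> E" for E x y
    using that by (auto simp: extremal_def split: if_splits)
  have "\<not> 10 \<le> a" "\<not> 10 \<le> b"
    using less[OF assms(1) _ assms(3)] less[OF assms(2) _ assms(4)]
      small[OF assms(1) _ assms(3)] small[OF assms(2) _ assms(4)] by linarith+
  then show ?thesis using small[OF assms(1) _ assms(3)] small[OF assms(2) _ assms(4)] by blast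
qed

lemma card_extremal_small:
  assumes "2 \<le> a" "a \<le> 9"
  shows "card (extremal a) = 21"
proof -
  let ?E = "{e. e \<subseteq> {2..9} - {a} \<and> card e = 2}"
  have "extremal a = insert 1 ` ?E"
  proof (intro set_eqI iffI)
    fix C assume "C \<in> extremal a"
    then have C: "C \<subseteq> {1..9} - {a}" "1 \<in> C" "card C = 3" using assms by (auto simp: extremal_def)
    have "C - {1} \<subseteq> {2..9} - {a}"
    proof
      fix x assume "x \<in> C - {1}"
      then have "x \<in> {1..9} - {a}" "x \<noteq> 1" using C by auto
      then show "x \<in> {2..9} - {a}" by auto
    qed
    then have "C - {1} \<in> ?E" using C by simp
    moreover have "C = insert 1 (C - {1})" using C by auto
    ultimately show "C \<in> insert 1 ` ?E" by blast
  next
    fix C assume "C \<in> insert 1 ` ?E"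
    then obtain e where e: "C = insert 1 e" "e \<subseteq> {2..9} - {a}" "card e = 2" by auto
    have "{2..9} - {a} \<subseteq> {1..9} - {a}" by auto
    with e have "e \<subseteq> {1..9} - {a}" by blast
    moreover have "finite e" using e(3) by (intro card_ge_0_finite) simp
    moreover have "1 \<notin> e" using e(2) by auto
    ultimately show "C \<in> extremal a" using assms e by (simp add: extremal_def)
  qed
  moreover have "inj_on (insert 1) ?E" by (rule inj_on_inverseI[of _ "\<lambda>C. C - {1}"]) auto
  ultimately have "card (extremal a) = card ?E" by (simp add: card_image)
  then show ?thesis using n_subsets[of "{2..9} - {a}" 2] assms by (simp add: choose_two)
qed

text \<open>At n = 9 eight points carry 21 triples each, and 168 = 126 + 42; every further point
  adds the amount given by Pascal's rule.\<close>

lemma sum_extremal: "9 \<le> n \<Longrightarrow> (\<Sum>a\<in>{1..n}. card (extremal a)) = (n choose 4) + 42"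
proof (induction n rule: dec_induct)
  case base
  have "{1..9::nat} = insert 1 {2..9}" by auto
  moreover have "(\<Sum>a\<in>{2..9}. card (extremal a)) = (\<Sum>a\<in>{2..9::nat}. 21)"
    by (intro sum.cong) (auto simp: card_extremal_small)
  moreover have "(9 choose 4) = (126 :: nat)" by (simp add: binomial_fact_lemma eval_nat_numeral)
  ultimately show ?case by (simp add: extremal_def)
next
  case (step n)
  have "card (extremal (Suc n)) = n choose 3"
    using step.hyps n_subsets[of "{1..<Suc n}" 3] by (simp add: extremal_def)
  then show ?case using step by (simp add: eval_nat_numeral)
qed

theorem theorem1p3:
  fixes n :: nat
  assumes "n \<ge> 9"
  shows "independence_number (Gamma n 1 (n - 3)) = (n choose 4) + 42"
proof -
  let ?G = "Gamma n 1 (n - 3)"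
  let ?A = "SIGMA a:{1..n}. extremal a"
  have A: "?A \<subseteq> pointed n"
  proof clarify
    fix a C assume a: "a \<in> {1..n}" and C: "C \<in> extremal a"
    have "{1..<a} \<subseteq> {1..n} - {a}" "{1..9} - {a} \<subseteq> {1..n} - {a}" using a assms by auto
    then have "C \<subseteq> {1..n} - {a}" using C by (auto simp only: extremal_def split: if_splits)
    then show "(a, C) \<in> pointed n" using a C by (auto simp: extremal_def pointed_def split: if_splits)
  qed
  have "independent_set ?G (to_flag n ` ?A)"
    unfolding independent_to_flag_iff[OF assms A]
    using extremal_cross by blast
  moreover have "card (to_flag n ` ?A) = card ?A"
    using to_flag_inj_on[OF assms] A by (intro card_image) (rule inj_on_subset)
  moreover have "card ?A = (\<Sum>a\<in>{1..n}. card (extremal a))"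
    by (intro card_SigmaI) (auto simp: extremal_def)
  ultimately have "(n choose 4) + 42 \<in> card ` {S. independent_set ?G S}"
    using sum_extremal[OF assms] by (intro image_eqI[of _ _ "to_flag n ` ?A"]) auto
  moreover have "finite {S. independent_set ?G S}"
  proof (rule finite_subset)
    show "{S. independent_set ?G S} \<subseteq> Pow (to_flag n ` pointed n)"
      using Gamma_vertices_eq[OF assms] by (auto simp: independent_set_def Gamma_def)
  qed (simp add: finite_pointed)
  ultimately show ?thesis
    unfolding independence_number_def using independent_card_le[OF assms]
    by (intro Max_eqI) auto
qed

end
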